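(* Let $p\ge 1$ be an integer, let $a_1,\ldots,a_{p+1},b_1,\ldots,b_p$ be complex numbers with no $a_j$ equal to a nonpositive integer, and put $s_p=b_1+\cdots+b_p-a_1-a_2-\cdots-a_{p+1}$. Suppose $\Re(a_j)>0$ for $j=3,\ldots,p+1$. If $s_p$ is equal to $1$, then the infinite series over $k$ below converges and $$\sum_{l=0}^{m-1}\frac{\Gamma(a_1+l)\Gamma(a_2+l)\cdots\Gamma(a_{p+1}+l)}{\Gamma(b_1+l)\cdots\Gamma(b_p+l)\Gamma(1+l)}=\frac{1}{a_1a_2}\sum_{k=0}^\infty\frac{(1)_k}{(a_1+1)_k(a_2+1)_k}A_k^{(p)}-(m-1)^{-1}$$ $$+\tfrac12\bigl[(a_1+1)(a_2+1)-A_1^{(p)}\bigr]\,[(m-1)(m-2)]^{-1}+O(m^{-3})$$ as $m\to\infty$ through the positive integers.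
   Context: $(x)_n=x(x+1)\cdots(x+n-1)=\Gamma(x+n)/\Gamma(x)$ is the Pochhammer symbol, $(x)_0=1$. The coefficients $A_k^{(p)}=A_k^{(p)}(a_3,\ldots,a_{p+1};b_1,\ldots,b_p)$, $k=0,1,2,\ldots$, are defined recursively in $p$: $A_0^{(1)}=1$ and $A_k^{(1)}=0$ for $k>0$; for $p\ge2$, $$A_k^{(p)}(a_3,\ldots,a_{p+1};b_1,\ldots,b_p)=\sum_{j=0}^{k}\frac{\bigl(\sum_{i=2}^{p}b_i-\sum_{i=3}^{p+1}a_i+j\bigr)_{k-j}\,(b_1-a_3)_{k-j}}{(k-j)!}\,A_j^{(p-1)}(a_4,\ldots,a_{p+1};b_2,\ldots,b_p).$$ For example $A_k^{(2)}=(b_2-a_3)_k(b_1-a_3)_k/k!$ and $A_k^{(3)}=\sum_{j=0}^k\frac{(b_3+b_2-a_4-a_3+j)_{k-j}(b_1-a_3)_{k-j}(b_3-a_4)_j(b_2-a_4)_j}{(k-j)!\,j!}$. The parameters are fixed and $m\to\infty$. $1/\Gamma$ is regarded as an entire function (zero at nonpositive integers). *)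

theory Defs
  imports "HOL-Analysis.Analysis" "HOL-Library.Landau_Symbols"
begin

text \<open>
  Parameters are one-based sequences \<open>a\<close>, \<open>b\<close>; only \<open>a 3, \<dots>, a (p + 1)\<close> and
  \<open>b 1, \<dots>, b p\<close> enter \<open>hyp_coeff p a b k\<close>. The recursion passes to
  \<open>(a 4, \<dots>, a (p + 1); b 2, \<dots>, b p)\<close>, which become the new third, fourth, \<open>\<dots>\<close> and
  first, second, \<open>\<dots>\<close> parameters; hence both sequences are shifted by one.
  The value for \<open>p = 0\<close> is left unspecified. In the second equation \<open>p = q + 2\<close>.
\<close>

fun hyp_coeff :: "nat \<Rightarrow> (nat \<Rightarrow> complex) \<Rightarrow> (nat \<Rightarrow> complex) \<Rightarrow> nat \<Rightarrow> complex" where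
  "hyp_coeff (Suc 0) a b k = (if k = 0 then 1 else 0)"
| "hyp_coeff (Suc (Suc q)) a b k =
     (\<Sum>j=0..k.
        pochhammer ((\<Sum>i=2..q+2. b i) - (\<Sum>i=3..q+3. a i) + of_nat j) (k - j)
          * pochhammer (b 1 - a 3) (k - j) / fact (k - j)
          * hyp_coeff (Suc q) (\<lambda>i. a (Suc i)) (\<lambda>i. b (Suc i)) j)"

end

theory Submission
  imports Defs "HOL-Real_Asymp.Real_Asymp"
begin

text \<open>
  Write \<open>\<sigma> = b\<^sub>1 + \<dots> + b\<^sub>p - a\<^sub>3 - \<dots> - a\<^sub>p\<^sub>+\<^sub>1\<close>. The coefficients \<open>A\<^sub>k\<close> are exactly those of
  the inverse factorial series
  \<open>(\<Sum>k. A\<^sub>k / \<Gamma>(\<sigma> + k + z)) = (\<Prod>j\<ge>3. \<Gamma>(a\<^sub>j + z)) / (\<Prod>j. \<Gamma>(b\<^sub>j + z))\<close>,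
  valid for \<open>Re z > - min (Re a\<^sub>j)\<close> (\<open>hyp_coeff_sums\<close>). Passing from \<open>p - 1\<close> to \<open>p\<close> multiplies
  such a series by \<open>\<Gamma>(a\<^sub>3 + z) / \<Gamma>(b\<^sub>1 + z)\<close>; after the order of summation is exchanged, this is
  Gauss's evaluation of the hypergeometric series at 1 (\<open>gauss_hypergeometric_sums\<close>), applied to each
  term of the shorter series.

  The exchange is legitimate only where the double series converges absolutely, which it need not do
  if \<open>Re b\<^sub>1 < Re a\<^sub>3\<close>. In that case \<open>\<Gamma>(a + z) / \<Gamma>(b + z)\<close> is replaced by
  \<open>(b + z)\<^sub>N \<cdot> \<Gamma>(a + z) / \<Gamma>(b + N + z)\<close>: for large \<open>N\<close> the second factor is harmless, and
  multiplication by a linear factor \<open>e + z\<close> acts on the coefficients by a two-term formula. A naive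
  estimate of that formula loses a power of \<open>k\<close>. So the class of coefficient sequences carried through
  the recursion, \<open>fs_regular\<close>, demands the growth bound for the sequence and for all sequences obtained
  from it by multiplication with linear factors. It contains the finite sequences, hence \<open>A\<close> for
  \<open>p = 1\<close>, and it is closed under the recursion because the two kinds of multiplication commute
  (\<open>lin_coeff_gquot_coeff\<close>).

  At \<open>z = l\<close> the expansion turns the \<open>l\<close>-th term of the sum into
  \<open>\<Gamma>(a\<^sub>1 + l) \<Gamma>(a\<^sub>2 + l) / l! \<cdot> \<Sum>k. A\<^sub>k / \<Gamma>(\<sigma> + k + l)\<close>, where \<open>\<sigma> = a\<^sub>1 + a\<^sub>2 + 1\<close> because
  \<open>s\<^sub>p = 1\<close>. Exchanging once more and summing over \<open>l\<close> by Gauss gives the constant term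
  (\<open>fs_gauss_sums\<close>). Finally the \<open>l\<close>-th term is \<open>l\<^sup>-\<^sup>2 + c l\<^sup>-\<^sup>3 + O(l\<^sup>-\<^sup>4)\<close> with an explicit \<open>c\<close>
  (\<open>gamma_ratio_expansion\<close>), \<open>A\<^sub>1\<close> is a matching quadratic expression in the parameters (\<open>hyp_coeff_1\<close>),
  and comparing increments of both sides controls the remainder (\<open>partial_sum_expansion\<close>).
\<close>

section \<open>Growth of Pochhammer symbols and Gamma functions\<close>

text \<open>
  For real \<open>t\<close> outside the nonpositive integers this has the order of magnitude of \<open>\<Gamma>(t + n)\<close>, but it
  is positive for every \<open>t\<close>. It measures the growth of all Gamma-type sequences below.
\<close>

definition gamma_weight :: "nat \<Rightarrow> real \<Rightarrow> real" where
  "gamma_weight n t = fact n * (real n + 1) powr (t - 1)"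

lemma gamma_weight_pos: "gamma_weight n t > 0"
  by (simp add: gamma_weight_def)

lemma gamma_weight_Suc: "gamma_weight (Suc n) t = gamma_weight n t * ((real n + 1) * ((real n + 2) / (real n + 1)) powr (t - 1))"
  by (simp add: gamma_weight_def powr_divide field_simps)

lemma gamma_weight_add: "gamma_weight n (s + t) = gamma_weight n s * (real n + 1) powr t"
  by (simp add: gamma_weight_def powr_add [symmetric] algebra_simps)

lemma bigo_imp_bounded:
  fixes f g :: "nat \<Rightarrow> real"
  assumes "f \<in> O(g)" "\<And>n. g n > 0"
  obtains C where "C > 0" "\<And>n. norm (f n) \<le> C * g n"
proof -
  from assms(1) obtain c where c: "c > 0" "eventually (\<lambda>n. norm (f n) \<le> c * norm (g n)) sequentially"
    by (elim landau_o.bigE)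
  then obtain N where N: "\<And>n. n \<ge> N \<Longrightarrow> norm (f n) \<le> c * g n"
    using assms(2) by (force simp: eventually_sequentially abs_of_pos)
  define C where "C = c + (\<Sum>k<N. norm (f k) / g k)"
  have nn: "norm (f k) / g k \<ge> 0" for k using assms(2)[of k] by simp
  have "norm (f n) \<le> C * g n" for n
  proof (cases "n < N")
    case True
    then have "norm (f n) / g n \<le> (\<Sum>k<N. norm (f k) / g k)"
      using nn by (intro member_le_sum) auto
    then have "norm (f n) / g n \<le> C" using c(1) by (simp add: C_def)
    then show ?thesis using assms(2)[of n] by (simp add: field_simps)
  next
    case False
    then have "norm (f n) \<le> c * g n" using N by simp
    also have "\<dots> \<le> C * g n"
      using sum_nonneg[of "{..<N}" "\<lambda>k. norm (f k) / g k"] nn assms(2)[of n]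
      by (intro mult_right_mono) (auto simp: C_def less_imp_le)
    finally show ?thesis .
  qed
  moreover have "C > 0" using c(1) sum_nonneg[of "{..<N}" "\<lambda>k. norm (f k) / g k"] nn
    by (simp add: C_def add_pos_nonneg)
  ultimately show ?thesis using that by blast
qed

text \<open>
  The quotient on the right is \<open>k + Re x + O(1/k)\<close>, so only a quadratically small relative error
  remains. The product of these errors over any range of \<open>k\<close> is bounded, which is what makes the
  bound on Pochhammer symbols uniform in their starting point, zeros included.
\<close>
lemma norm_shift_le:
  fixes x :: complex
  obtains C where "C > 0"
    "\<And>k. norm (x + of_nat k) \<le> gamma_weight (Suc k) (Re x) / gamma_weight k (Re x) * (1 + C / (real k + 1)\<^sup>2)"
proof -
  define s y where "s = Re x" and "y = Im x"
  define q where "q = (\<lambda>k::nat. (real k + 1) * ((real k + 2) / (real k + 1)) powr (s - 1))"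
  have qpos: "q k > 0" for k by (simp add: q_def)
  have "(\<lambda>k::nat. sqrt ((real k + s)\<^sup>2 + y\<^sup>2) / q k - 1) \<in> O(\<lambda>k. 1 / (real k + 1)\<^sup>2)"
    unfolding q_def by real_asymp
  then obtain C where C: "C > 0"
    "\<And>k. norm (sqrt ((real k + s)\<^sup>2 + y\<^sup>2) / q k - 1) \<le> C * (1 / (real k + 1)\<^sup>2)"
    by (rule bigo_imp_bounded) auto
  have "norm (x + of_nat k) \<le> gamma_weight (Suc k) (Re x) / gamma_weight k (Re x) * (1 + C / (real k + 1)\<^sup>2)" for k
  proof -
    have "gamma_weight (Suc k) (Re x) / gamma_weight k (Re x) = q k"
      using gamma_weight_pos[of k "Re x"] by (simp add: gamma_weight_Suc q_def s_def)
    moreover have "norm (x + of_nat k) = sqrt ((real k + s)\<^sup>2 + y\<^sup>2)"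
      by (simp add: cmod_def s_def y_def add.commute)
    moreover have "sqrt ((real k + s)\<^sup>2 + y\<^sup>2) / q k \<le> 1 + C / (real k + 1)\<^sup>2"
      using C(2)[of k] by (auto simp: abs_le_iff)
    ultimately show ?thesis using qpos[of k] by (simp add: field_simps)
  qed
  with C(1) that show ?thesis by blast
qed

lemma pochhammer_le_gamma_weight:
  fixes x :: complex
  obtains C where "C > 0"
    "\<And>j i. norm (pochhammer (x + of_nat j) i) \<le> C * (gamma_weight (j + i) (Re x) / gamma_weight j (Re x))"
proof -
  obtain c where c: "c > 0"
    "\<And>k. norm (x + of_nat k) \<le> gamma_weight (Suc k) (Re x) / gamma_weight k (Re x) * (1 + c / (real k + 1)\<^sup>2)"
    using norm_shift_le[of x] by blast
  define h where "h = (\<lambda>k::nat. c / (real k + 1)\<^sup>2)"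
  have sm: "summable h"
    using summable_mult[OF summable_ignore_initial_segment[OF inverse_power_summable[of 2, where ?'a = real], of 1], of c]
    by (simp add: h_def field_simps)
  have hnn: "h k \<ge> 0" for k using c(1) by (simp add: h_def)
  have fin: "norm (pochhammer (x + of_nat j) i)
      \<le> gamma_weight (j + i) (Re x) / gamma_weight j (Re x) * exp (\<Sum>k=j..<j+i. h k)" for i j
  proof (induction i)
    case 0
    then show ?case using gamma_weight_pos[of j "Re x"] by simp
  next
    case (Suc i)
    have "norm (pochhammer (x + of_nat j) (Suc i))
        = norm (pochhammer (x + of_nat j) i) * norm (x + of_nat (j + i))"
      by (simp add: pochhammer_Suc norm_mult add.assoc)
    also have "\<dots> \<le> (gamma_weight (j + i) (Re x) / gamma_weight j (Re x) * exp (\<Sum>k=j..<j+i. h k))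
        * (gamma_weight (Suc (j + i)) (Re x) / gamma_weight (j + i) (Re x) * exp (h (j + i)))"
    proof (intro mult_mono)
      have "norm (x + of_nat (j + i)) \<le> gamma_weight (Suc (j + i)) (Re x) / gamma_weight (j + i) (Re x) * (1 + h (j + i))"
        using c(2)[of "j + i"] by (simp add: h_def)
      also have "\<dots> \<le> gamma_weight (Suc (j + i)) (Re x) / gamma_weight (j + i) (Re x) * exp (h (j + i))"
        by (intro mult_left_mono exp_ge_add_one_self) (simp add: gamma_weight_pos less_imp_le)
      finally show "norm (x + of_nat (j + i)) \<le> \<dots>" .
    qed (use Suc gamma_weight_pos in \<open>auto simp: less_imp_le\<close>)
    also have "\<dots> = gamma_weight (j + Suc i) (Re x) / gamma_weight j (Re x) * exp (\<Sum>k=j..<j+Suc i. h k)"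
      using gamma_weight_pos[of "j + i" "Re x"] by (simp add: exp_add field_simps)
    finally show ?case .
  qed
  have "norm (pochhammer (x + of_nat j) i) \<le> exp (suminf h) * (gamma_weight (j + i) (Re x) / gamma_weight j (Re x))" for i j
  proof -
    have "(\<Sum>k=j..<j+i. h k) \<le> suminf h"
      using sm hnn by (intro sum_le_suminf) auto
    then have "gamma_weight (j + i) (Re x) / gamma_weight j (Re x) * exp (\<Sum>k=j..<j+i. h k)
      \<le> gamma_weight (j + i) (Re x) / gamma_weight j (Re x) * exp (suminf h)"
      by (intro mult_left_mono) (auto simp: gamma_weight_pos less_imp_le)
    then show ?thesis using fin[of j i] by (simp add: mult.commute)
  qed
  then show ?thesis using that[of "exp (suminf h)"] by simp
qed

lemma pochhammer_le_gamma_weight_0: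
  fixes x :: complex
  obtains C where "C > 0" "\<And>n. norm (pochhammer x n) \<le> C * gamma_weight n (Re x)"
proof -
  obtain C where C: "C > 0"
    "\<And>j i. norm (pochhammer (x + of_nat j) i) \<le> C * (gamma_weight (j + i) (Re x) / gamma_weight j (Re x))"
    using pochhammer_le_gamma_weight[of x] by blast
  show ?thesis using that[of C] C(1) C(2)[of 0] by (simp add: gamma_weight_def)
qed

lemma Gamma_le_gamma_weight:
  fixes x :: complex
  assumes "x \<notin> \<int>\<^sub>\<le>\<^sub>0"
  obtains C where "C > 0" "\<And>n. norm (Gamma (x + of_nat n)) \<le> C * gamma_weight n (Re x)"
proof -
  obtain C where C: "C > 0" "\<And>n. norm (pochhammer x n) \<le> C * gamma_weight n (Re x)"
    using pochhammer_le_gamma_weight_0[of x] by blast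
  have "norm (Gamma (x + of_nat n)) \<le> (C * norm (Gamma x)) * gamma_weight n (Re x)" for n
  proof -
    have "Gamma (x + of_nat n) = pochhammer x n * Gamma x"
      using pochhammer_Gamma[OF assms, of n] Gamma_eq_zero_iff[of x] assms by simp
    then show ?thesis using mult_right_mono[OF C(2)[of n], of "norm (Gamma x)"]
      by (simp add: norm_mult mult_ac)
  qed
  moreover have "C * norm (Gamma x) > 0"
    using C(1) assms by (simp add: Gamma_eq_zero_iff)
  ultimately show ?thesis using that by blast
qed

lemma gamma_weight_shift_limit:
  "(\<lambda>m. gamma_weight (n + m) t / (fact m * real m powr (t + real n - 1))) \<longlonglongrightarrow> 1"
proof (induction n)
  case 0
  have "(\<lambda>m::nat. ((real m + 1) / real m) powr (t - 1)) \<longlonglongrightarrow> 1" by real_asymp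
  then show ?case
    by (rule Lim_transform_eventually)
       (intro eventually_mono[OF eventually_gt_at_top[of 0]], simp add: gamma_weight_def powr_divide)
next
  case (Suc n)
  have "(\<lambda>m::nat. (real (n + m) + 1) / real m * ((real (n + m) + 2) / (real (n + m) + 1)) powr (t - 1)) \<longlonglongrightarrow> 1"
    by real_asymp
  from tendsto_mult[OF Suc this]
  have "(\<lambda>m. gamma_weight (n + m) t / (fact m * real m powr (t + real n - 1)) *
      ((real (n + m) + 1) / real m * ((real (n + m) + 2) / (real (n + m) + 1)) powr (t - 1))) \<longlonglongrightarrow> 1"
    by simp
  then show ?case
  proof (rule Lim_transform_eventually)
    show "eventually (\<lambda>m. gamma_weight (n + m) t / (fact m * real m powr (t + real n - 1)) *
        ((real (n + m) + 1) / real m * ((real (n + m) + 2) / (real (n + m) + 1)) powr (t - 1))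
        = gamma_weight (Suc n + m) t / (fact m * real m powr (t + real (Suc n) - 1))) sequentially"
      using eventually_gt_at_top[of 0]
    proof eventually_elim
      case (elim m)
      have "real m powr (t + real (Suc n) - 1) = real m powr (t + real n - 1) * real m"
        using elim powr_add[of "real m" "t + real n - 1" 1] by (simp add: algebra_simps)
      then show ?case by (simp add: gamma_weight_Suc)
    qed
  qed
qed

text \<open>
  The bound passes to the limit in Euler's product \<open>rGamma_series (x + n)\<close>, whose numerator is
  controlled uniformly in \<open>n\<close>. No case distinction for the zeros of \<open>rGamma\<close> arises.
\<close>
lemma rGamma_le_gamma_weight:
  fixes x :: complex
  obtains C where "C > 0" "\<And>n. norm (rGamma (x + of_nat n)) \<le> C / gamma_weight n (Re x)"
proof -
  obtain C where C: "C > 0"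
    "\<And>j i. norm (pochhammer (x + of_nat j) i) \<le> C * (gamma_weight (j + i) (Re x) / gamma_weight j (Re x))"
    using pochhammer_le_gamma_weight[of x] by blast
  have "norm (rGamma (x + of_nat n)) \<le> C / gamma_weight n (Re x)" for n
  proof (rule LIMSEQ_le)
    show "(\<lambda>m. norm (rGamma_series (x + of_nat n) m)) \<longlonglongrightarrow> norm (rGamma (x + of_nat n))"
      by (intro tendsto_intros)
    show "(\<lambda>m. C / gamma_weight n (Re x) * (gamma_weight (Suc n + m) (Re x) / (fact m * real m powr (Re x + real (Suc n) - 1))))
            \<longlonglongrightarrow> C / gamma_weight n (Re x)"
      using tendsto_mult_left[OF gamma_weight_shift_limit[of "Suc n" "Re x"], of "C / gamma_weight n (Re x)"] by simp
    have "norm (rGamma_series (x + of_nat n) m)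
        \<le> C / gamma_weight n (Re x) * (gamma_weight (Suc n + m) (Re x) / (fact m * real m powr (Re x + real (Suc n) - 1)))"
      if "m > 0" for m
    proof -
      have "norm (rGamma_series (x + of_nat n) m)
          = norm (pochhammer (x + of_nat n) (Suc m)) / (fact m * real m powr (Re x + real n))"
        using that by (simp add: rGamma_series_def norm_divide norm_mult powr_def)
      also have "\<dots> \<le> (C * (gamma_weight (n + Suc m) (Re x) / gamma_weight n (Re x))) / (fact m * real m powr (Re x + real n))"
        by (intro divide_right_mono C(2)) auto
      finally show ?thesis by (simp add: field_simps)
    qed
    then show "\<exists>N. \<forall>m\<ge>N. norm (rGamma_series (x + of_nat n) m)
        \<le> C / gamma_weight n (Re x) * (gamma_weight (Suc n + m) (Re x) / (fact m * real m powr (Re x + real (Suc n) - 1)))"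
      by (intro exI[of _ 1]) auto
  qed
  with C(1) that show ?thesis by blast
qed

section \<open>Rearranging dominated double series\<close>

text \<open>
  A product of summable majorants makes the whole family absolutely summable, so summation by rows,
  by columns and by antidiagonals gives the same value.
\<close>
lemma double_series:
  fixes f :: "nat \<Rightarrow> nat \<Rightarrow> 'a :: banach" and u v :: "nat \<Rightarrow> real"
  assumes bound: "\<And>j i. norm (f j i) \<le> v j * u i"
    and "summable u" "summable v" "\<And>i. u i \<ge> 0" "\<And>j. v j \<ge> 0"
    and rows: "\<And>j. (\<lambda>i. f j i) sums g j"
  shows double_series_antidiagonal: "(\<lambda>k. \<Sum>j\<le>k. f j (k - j)) sums suminf g"
    and double_series_rows: "summable g"
    and double_series_swap: "(\<And>i. (\<lambda>j. f j i) sums h i) \<Longrightarrow> h sums suminf g"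
proof -
  have maj: "(\<lambda>(j, i). v j * u i) summable_on (UNIV \<times> UNIV)"
  proof (rule summable_on_SigmaI)
    show "((\<lambda>i. case (j, i) of (j, i) \<Rightarrow> v j * u i) has_sum (v j * suminf u)) UNIV" for j
      using assms(2,4,5) by (auto intro!: sums_nonneg_imp_has_sum sums_mult summable_sums)
    show "(\<lambda>j. v j * suminf u) summable_on UNIV"
      using assms(2-5) by (intro summable_nonneg_imp_summable_on summable_mult2 mult_nonneg_nonneg suminf_nonneg)
  qed (use assms in auto)
  have abs: "(\<lambda>(j, i). norm (f j i)) summable_on (UNIV \<times> UNIV)"
    by (rule summable_on_comparison_test[OF maj]) (use bound in auto)
  then have "(\<lambda>(j, i). f j i) summable_on (UNIV \<times> UNIV)"
    by (intro abs_summable_summable[of "\<lambda>(j, i). f j i"]) (simp only: case_prod_unfold)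
  then obtain S where S: "((\<lambda>(j, i). f j i) has_sum S) (UNIV \<times> UNIV)"
    by (auto simp: summable_on_def)
  have row: "((\<lambda>i. f j i) has_sum g j) UNIV" for j
  proof (rule norm_summable_imp_has_sum)
    show "summable (\<lambda>i. norm (f j i))"
      by (rule summable_comparison_test'[OF summable_mult[OF assms(2), of "v j"], of 0]) (use bound in auto)
  qed (rule rows)
  have "(g has_sum S) UNIV"
    by (rule has_sum_SigmaD[OF S]) (use row in auto)
  then have gs: "g sums S" by (rule has_sum_imp_sums)
  then have gS: "suminf g = S" by (rule sums_unique[symmetric])
  from gs show "summable g" by (rule sums_summable)
  show "(\<lambda>k. \<Sum>j\<le>k. f j (k - j)) sums suminf g"
  proof -
    have "((\<lambda>(k, j). f j (k - j)) has_sum S) (SIGMA k:UNIV. {..k})"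
      using S
      by (subst has_sum_reindex_bij_witness[of _ "\<lambda>(j, i). (j + i, j)" "\<lambda>(k, j). (j, k - j)"
            "UNIV \<times> UNIV" "\<lambda>(j, i). f j i"]) auto
    then have "((\<lambda>k. \<Sum>j\<le>k. f j (k - j)) has_sum S) UNIV"
      by (rule has_sum_SigmaD) (auto intro!: has_sum_finiteI)
    then show ?thesis unfolding gS by (rule has_sum_imp_sums)
  qed
  show "h sums suminf g" if h: "\<And>i. (\<lambda>j. f j i) sums h i"
  proof -
    have swapped: "((\<lambda>(i, j). f j i) has_sum S) (UNIV \<times> UNIV)"
      using S
      by (subst has_sum_reindex_bij_witness[of _ "\<lambda>(j, i). (i, j)" "\<lambda>(i, j). (j, i)"
            "UNIV \<times> UNIV" "\<lambda>(j, i). f j i"]) auto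
    have col: "((\<lambda>j. f j i) has_sum h i) UNIV" for i
    proof (rule norm_summable_imp_has_sum)
      show "summable (\<lambda>j. norm (f j i))"
        by (rule summable_comparison_test'[OF summable_mult2[OF assms(3), of "u i"], of 0]) (use bound in auto)
    qed (rule h)
    have "(h has_sum S) UNIV"
      by (rule has_sum_SigmaD[OF swapped]) (use col in simp)
    then show ?thesis unfolding gS by (rule has_sum_imp_sums)
  qed
qed

lemma summable_shifted_powr:
  assumes "s < -1"
  shows "summable (\<lambda>n. (real n + 1) powr s)"
proof -
  have "summable (\<lambda>n. real (n + 1) powr s)"
    using assms by (subst summable_iff_shift) (simp add: summable_real_powr_iff)
  then show ?thesis by (simp add: add.commute)
qed

lemma nat_shift_positive:
  fixes r :: real
  obtains N :: nat where "r + real N > 0"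
proof -
  obtain N :: nat where "- r < real N" using reals_Archimedean2 by blast
  then show ?thesis by (intro that[of N]) simp
qed

section \<open>Gauss's summation theorem\<close>

text \<open>
  Stirling's formula in Euler's form. Outside the nonpositive integers it is Euler's product; the
  remaining points are reached by shifting \<open>x\<close> by one.
\<close>
lemma rGamma_limit:
  fixes x :: complex
  shows "(\<lambda>n. rGamma (x + of_nat (Suc n)) * fact n * exp (x * of_real (ln (real n)))) \<longlonglongrightarrow> 1"
proof -
  have regular: "(\<lambda>n. rGamma (x + of_nat (Suc n)) * fact n * exp (x * of_real (ln (real n)))) \<longlonglongrightarrow> 1"
    if x: "x \<notin> \<int>\<^sub>\<le>\<^sub>0" for x :: complex
  proof -
    have "(\<lambda>n. rGamma x / rGamma_series x n) \<longlonglongrightarrow> rGamma x / rGamma x"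
      using x by (intro tendsto_intros) (auto simp: rGamma_eq_zero_iff)
    moreover have "rGamma x / rGamma_series x n
        = rGamma (x + of_nat (Suc n)) * fact n * exp (x * of_real (ln (real n)))" for n
      using pochhammer_rGamma[of x "Suc n"] x pochhammer_eq_0_imp_nonpos_Int[of x "Suc n"]
      by (auto simp: rGamma_series_def)
    ultimately show ?thesis using x by (simp add: rGamma_eq_zero_iff)
  qed
  have shift: "(\<lambda>n. rGamma (x + of_nat (Suc n)) * fact n * exp (x * of_real (ln (real n)))) \<longlonglongrightarrow> 1"
    if lim: "(\<lambda>n. rGamma (x + 1 + of_nat (Suc n)) * fact n * exp ((x + 1) * of_real (ln (real n)))) \<longlonglongrightarrow> 1"
    for x :: complex
  proof (rule LIMSEQ_imp_Suc)
    have "(\<lambda>n. ln (real (Suc n) / real n)) \<longlonglongrightarrow> 0"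
      by real_asymp
    then have "(\<lambda>n. exp (x * of_real (ln (real (Suc n) / real n)))) \<longlonglongrightarrow> exp (x * of_real 0)"
      by (intro tendsto_intros)
    moreover have "(\<lambda>n. complex_of_real (real (Suc n) / real n)) \<longlonglongrightarrow> of_real 1"
      by (intro tendsto_of_real) real_asymp
    ultimately have "(\<lambda>n. (rGamma (x + 1 + of_nat (Suc n)) * fact n * exp ((x + 1) * of_real (ln (real n))))
        * exp (x * of_real (ln (real (Suc n) / real n))) * of_real (real (Suc n) / real n)) \<longlonglongrightarrow> 1 * exp (x * of_real 0) * of_real 1"
      by (intro tendsto_mult lim)
    then have "(\<lambda>n. (rGamma (x + 1 + of_nat (Suc n)) * fact n * exp ((x + 1) * of_real (ln (real n))))
        * exp (x * of_real (ln (real (Suc n) / real n))) * of_real (real (Suc n) / real n)) \<longlonglongrightarrow> 1"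
      by simp
    then show "(\<lambda>n. rGamma (x + of_nat (Suc (Suc n))) * fact (Suc n) * exp (x * of_real (ln (real (Suc n))))) \<longlonglongrightarrow> 1"
    proof (rule Lim_transform_eventually)
      show "\<forall>\<^sub>F n in sequentially. (rGamma (x + 1 + of_nat (Suc n)) * fact n * exp ((x + 1) * of_real (ln (real n))))
        * exp (x * of_real (ln (real (Suc n) / real n))) * of_real (real (Suc n) / real n)
        = rGamma (x + of_nat (Suc (Suc n))) * fact (Suc n) * exp (x * of_real (ln (real (Suc n))))"
        using eventually_gt_at_top[of 0]
      proof eventually_elim
        case (elim n)
        have 1: "exp ((x + 1) * of_real (ln (real n))) = exp (x * of_real (ln (real n))) * of_nat n"
          using elim by (simp add: distrib_right exp_add exp_of_real)
        have 2: "exp (x * of_real (ln (real (Suc n)))) = exp (x * of_real (ln (real n))) * exp (x * of_real (ln (real (Suc n) / real n)))"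
          using elim by (simp add: ln_div exp_add[symmetric] algebra_simps del: of_nat_Suc)
        show ?case unfolding 1 2 using elim by (simp add: add_ac)
      qed
    qed
  qed
  have "(\<lambda>n. rGamma (x + of_nat (Suc n)) * fact n * exp (x * of_real (ln (real n)))) \<longlonglongrightarrow> 1"
    if "Re x + real M > 0" for M and x :: complex
    using that
  proof (induction M arbitrary: x)
    case 0
    then show ?case by (intro regular) (auto elim!: nonpos_Ints_cases)
  next
    case (Suc M)
    then have "Re (x + 1) + real M > 0" by simp
    from shift[OF Suc.IH[OF this]] show ?case .
  qed
  moreover obtain M where "Re x + real M > 0"
    using nat_shift_positive by blast
  ultimately show ?thesis by blast
qed

text \<open>
  Both sides of Gauss's formula satisfy the same first-order recurrence \<open>c \<mapsto> c + 1\<close>: for the series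
  it is obtained by telescoping (\<open>gauss_contiguous\<close>). So their quotient is 1-periodic in \<open>c\<close>, and it
  tends to 1 as \<open>c\<close> moves to the right (\<open>gauss_limit\<close>).
\<close>

context
  fixes x y :: complex
begin

definition gauss_term :: "complex \<Rightarrow> nat \<Rightarrow> complex" where
  "gauss_term c n = pochhammer x n * pochhammer y n / fact n * rGamma (c + of_nat n)"

lemma gauss_term_le:
  obtains C where "C > 0" "\<And>n. norm (gauss_term c n) \<le> C * (real n + 1) powr (- Re (c - x - y) - 1)"
proof -
  obtain C1 where C1: "C1 > 0" "\<And>n. norm (pochhammer x n) \<le> C1 * gamma_weight n (Re x)"
    using pochhammer_le_gamma_weight_0[of x] by blast
  obtain C2 where C2: "C2 > 0" "\<And>n. norm (pochhammer y n) \<le> C2 * gamma_weight n (Re y)"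
    using pochhammer_le_gamma_weight_0[of y] by blast
  obtain C3 where C3: "C3 > 0" "\<And>n. norm (rGamma (c + of_nat n)) \<le> C3 / gamma_weight n (Re c)"
    using rGamma_le_gamma_weight[of c] by blast
  have "norm (gauss_term c n) \<le> (C1 * C2 * C3) * (real n + 1) powr (- Re (c - x - y) - 1)" for n
  proof -
    have "norm (gauss_term c n) \<le> (C1 * gamma_weight n (Re x)) * (C2 * gamma_weight n (Re y)) / fact n * (C3 / gamma_weight n (Re c))"
      unfolding gauss_term_def norm_mult norm_divide norm_fact
      using C1 C2 C3 gamma_weight_pos by (intro mult_mono divide_right_mono) (auto simp: less_imp_le)
    also have "\<dots> = (C1 * C2 * C3) * (gamma_weight n (Re x) * gamma_weight n (Re y) / fact n / gamma_weight n (Re c))"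
      by simp
    also have "gamma_weight n (Re x) * gamma_weight n (Re y) / fact n / gamma_weight n (Re c) = (real n + 1) powr (- Re (c - x - y) - 1)"
      by (simp add: gamma_weight_def powr_add[symmetric] powr_diff[symmetric] divide_simps) (simp add: powr_add[symmetric] algebra_simps)
    finally show ?thesis .
  qed
  with that[of "C1 * C2 * C3"] C1 C2 C3 show ?thesis by simp
qed

lemma summable_gauss_term:
  assumes "Re (c - x - y) > 0"
  shows "summable (\<lambda>n. norm (gauss_term c n))"
proof -
  obtain C where "C > 0" "\<And>n. norm (gauss_term c n) \<le> C * (real n + 1) powr (- Re (c - x - y) - 1)"
    using gauss_term_le[of c] by blast
  with assms show ?thesis
    by (intro summable_comparison_test'[OF summable_mult[OF summable_shifted_powr[of "- Re (c - x - y) - 1"], of C], of 0]) auto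
qed

lemma gauss_contiguous:
  assumes c: "Re (c - x - y) > 0"
  shows "(c - x) * (c - y) * suminf (gauss_term (c + 1)) = (c - x - y) * suminf (gauss_term c)"
proof -
  \<comment> \<open>With \<open>w\<close> as below, the left side of \<open>step\<close> is \<open>(xy - (c - x - y) n) w\<close>, and
    \<open>xy - (c - x - y) n = (x + n)(y + n) - n (c + n)\<close>.\<close>
  define v where "v n = of_nat n * gauss_term c n" for n
  have step: "(c - x) * (c - y) * gauss_term (c + 1) n - (c - x - y) * gauss_term c n = v (Suc n) - v n" for n
  proof -
    define w where "w = pochhammer x n * pochhammer y n / fact n * rGamma (c + 1 + of_nat n)"
    have r: "rGamma (c + of_nat n) = (c + of_nat n) * rGamma (c + 1 + of_nat n)"
      using rGamma_plus1[of "c + of_nat n"] by (simp add: add_ac)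
    have "gauss_term (c + 1) n = w" "gauss_term c n = (c + of_nat n) * w"
      by (simp_all add: gauss_term_def w_def r)
    moreover have "v (Suc n) = (x + of_nat n) * (y + of_nat n) * w"
    proof -
      have f: "(of_nat (Suc n) :: complex) / fact (Suc n) = 1 / fact n"
        by (simp add: fact_Suc del: of_nat_Suc)
      have "v (Suc n) = pochhammer x (Suc n) * pochhammer y (Suc n) * (of_nat (Suc n) / fact (Suc n))
          * rGamma (c + of_nat (Suc n))"
        by (simp only: v_def gauss_term_def times_divide_eq_right times_divide_eq_left mult_ac)
      also have "c + of_nat (Suc n) = c + 1 + of_nat n" by simp
      finally show ?thesis unfolding f by (simp add: w_def pochhammer_Suc mult_ac)
    qed
    ultimately show ?thesis by (simp add: v_def algebra_simps)
  qed
  obtain C where C: "C > 0" "\<And>n. norm (gauss_term c n) \<le> C * (real n + 1) powr (- Re (c - x - y) - 1)"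
    using gauss_term_le[of c] by blast
  have "v \<longlonglongrightarrow> 0"
  proof (rule Lim_null_comparison)
    show "\<forall>\<^sub>F n in sequentially. norm (v n) \<le> C * (real n + 1) powr (- Re (c - x - y))"
    proof (intro always_eventually allI)
      fix n
      have "norm (v n) \<le> (real n + 1) * (C * (real n + 1) powr (- Re (c - x - y) - 1))"
        unfolding v_def norm_mult norm_of_nat by (intro mult_mono C) auto
      also have "\<dots> = C * (real n + 1) powr (- Re (c - x - y))"
        by (simp add: powr_diff)
      finally show "norm (v n) \<le> \<dots>" .
    qed
    define r where "r = Re (c - x - y)"
    have "r > 0" using c by (simp add: r_def)
    then have "(\<lambda>n::nat. C * (real n + 1) powr (- r)) \<longlonglongrightarrow> 0"
      by real_asymp
    then show "(\<lambda>n::nat. C * (real n + 1) powr (- Re (c - x - y))) \<longlonglongrightarrow> 0"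
      by (simp only: r_def)
  qed
  then have "(\<lambda>n. v (Suc n) - v n) sums (0 - v 0)" by (rule telescope_sums)
  then have "(\<lambda>n. (c - x) * (c - y) * gauss_term (c + 1) n - (c - x - y) * gauss_term c n) sums 0"
    by (simp add: step v_def)
  moreover have "(\<lambda>n. (c - x) * (c - y) * gauss_term (c + 1) n - (c - x - y) * gauss_term c n)
      sums ((c - x) * (c - y) * suminf (gauss_term (c + 1)) - (c - x - y) * suminf (gauss_term c))"
    using c by (intro sums_diff sums_mult summable_sums summable_norm_cancel[OF summable_gauss_term]) auto
  ultimately show ?thesis using sums_unique2 by fastforce
qed

lemma gauss_contiguous_iterated:
  assumes c: "Re (c - x - y) > 0"
  shows "pochhammer (c - x) N * pochhammer (c - y) N * suminf (gauss_term (c + of_nat N))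
      = pochhammer (c - x - y) N * suminf (gauss_term c)"
proof (induction N)
  case (Suc N)
  have "Re (c + of_nat N - x - y) > 0" using c by simp
  note gauss_contiguous[OF this]
  moreover have "c + of_nat (Suc N) = c + of_nat N + 1" by simp
  ultimately have "pochhammer (c - x) (Suc N) * pochhammer (c - y) (Suc N) * suminf (gauss_term (c + of_nat (Suc N)))
      = pochhammer (c - x) N * pochhammer (c - y) N * ((c + of_nat N - x - y) * suminf (gauss_term (c + of_nat N)))"
    by (simp only: pochhammer_Suc) (simp only: diff_add_eq mult_ac)
  also have "\<dots> = (c + of_nat N - x - y) * (pochhammer (c - x - y) N * suminf (gauss_term c))"
    by (subst Suc.IH[symmetric]) (simp only: mult_ac)
  finally show ?case by (simp only: pochhammer_Suc diff_add_eq mult_ac)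
qed simp

lemma gauss_limit:
  assumes c: "Re (c - x - y) > 0"
  shows "(\<lambda>N. Gamma (c + of_nat N) * suminf (gauss_term (c + of_nat N))) \<longlonglongrightarrow> 1"
proof -
  obtain N0 :: nat where N0: "Re c + N0 > 0"
    using nat_shift_positive by blast
  define t where "t n N = pochhammer x n * pochhammer y n / fact n / pochhammer (c + of_nat N) n" for n N
  have nz: "c + of_nat N \<notin> \<int>\<^sub>\<le>\<^sub>0" if "N \<ge> N0" for N
    using that N0 by (auto elim!: nonpos_Ints_cases simp: complex_eq_iff)
  have eq: "Gamma (c + of_nat N) * gauss_term (c + of_nat N) n = t n N" if "N \<ge> N0" for n N
  proof -
    have "rGamma (c + of_nat N) = pochhammer (c + of_nat N) n * rGamma (c + of_nat N + of_nat n)"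
      by (rule pochhammer_rGamma)
    moreover have "rGamma (c + of_nat N) \<noteq> 0" "Gamma (c + of_nat N) = inverse (rGamma (c + of_nat N))"
      using nz[OF that] by (simp_all add: rGamma_eq_zero_iff Gamma_def)
    ultimately show ?thesis unfolding gauss_term_def t_def by (auto simp: field_simps)
  qed
  \<comment> \<open>Once the factors \<open>c + N + i\<close> lie in the right half-plane, their moduli increase with \<open>N\<close>;
    the term at \<open>N0\<close> is therefore a majorant.\<close>
  have mono: "norm (t n N) \<le> norm (t n N0)" if "N \<ge> N0" for n N
  proof -
    have "norm (pochhammer (c + of_nat N0) n) \<le> norm (pochhammer (c + of_nat N) n)"
      unfolding pochhammer_prod prod_norm[symmetric]
    proof (rule prod_mono)
      fix i
      show "0 \<le> norm (c + of_nat N0 + of_nat i) \<and> norm (c + of_nat N0 + of_nat i) \<le> norm (c + of_nat N + of_nat i)"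
        using that N0 by (auto simp: cmod_def intro!: real_sqrt_le_mono power_mono add_mono)
    qed
    moreover have "pochhammer (c + of_nat N0) n \<noteq> 0"
      using nz[of N0] pochhammer_eq_0_imp_nonpos_Int by blast
    ultimately show ?thesis
      unfolding t_def norm_divide
      by (intro divide_left_mono mult_pos_pos) (auto intro: less_le_trans[of 0 "norm (pochhammer (c + of_nat N0) n)"])
  qed
  have "summable (\<lambda>n. norm (Gamma (c + of_nat N0)) * norm (gauss_term (c + of_nat N0) n))"
    using c by (intro summable_mult summable_gauss_term) simp
  then have sm: "summable (\<lambda>n. norm (t n N0))"
    by (simp add: norm_mult[symmetric] eq)
  have lim: "(\<lambda>N. t n N) \<longlonglongrightarrow> (if n = 0 then 1 else 0)" for n
  proof (cases n)
    case 0
    then show ?thesis by (simp add: t_def)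
  next
    case (Suc m)
    have "filterlim (\<lambda>N. c + of_nat N + of_nat i) at_infinity sequentially" for i
    proof -
      have "filterlim (\<lambda>N. (c + of_nat i) + of_nat N) at_infinity sequentially"
        by (intro tendsto_add_filterlim_at_infinity[OF tendsto_const] tendsto_of_nat)
      then show ?thesis by (simp add: add_ac)
    qed
    then have inv: "(\<lambda>N. inverse (c + of_nat N + of_nat i)) \<longlonglongrightarrow> 0" for i
      by (intro filterlim_compose[OF tendsto_inverse_0])
    have "(\<lambda>N. \<Prod>i=0..<n. inverse (c + of_nat N + of_nat i)) \<longlonglongrightarrow> (\<Prod>i=0..<n. 0)"
      by (intro tendsto_prod inv)
    then have "(\<lambda>N. pochhammer x n * pochhammer y n / fact n * inverse (pochhammer (c + of_nat N) n))
       \<longlonglongrightarrow> pochhammer x n * pochhammer y n / fact n * 0"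
      by (intro tendsto_mult tendsto_const) (simp add: pochhammer_prod Suc prod_inversef[symmetric] o_def power_0_left)
    then show ?thesis using Suc by (simp add: t_def field_simps)
  qed
  have "(\<lambda>N. suminf (\<lambda>n. t n N)) \<longlonglongrightarrow> suminf (\<lambda>n. if n = 0 then 1 else 0)"
  proof (rule tannerys_theorem[THEN conjunct2, THEN conjunct2])
    show "\<forall>\<^sub>F (n, N) in at_top \<times>\<^sub>F sequentially. norm (t n N) \<le> norm (t n N0)"
      by (rule eventually_mono[OF eventually_prodI[OF eventually_True eventually_ge_at_top[of N0]]])
         (auto intro: mono)
  qed (use lim sm in auto)
  then have "(\<lambda>N. suminf (\<lambda>n. t n N)) \<longlonglongrightarrow> 1"
    using suminf_finite[of "{0}" "\<lambda>n::nat. if n = 0 then 1 else (0::complex)"] by simp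
  then show ?thesis
  proof (rule Lim_transform_eventually)
    show "\<forall>\<^sub>F N in sequentially. suminf (\<lambda>n. t n N) = Gamma (c + of_nat N) * suminf (gauss_term (c + of_nat N))"
      using eventually_ge_at_top[of N0]
    proof eventually_elim
      case (elim N)
      have "summable (gauss_term (c + of_nat N))"
        using c by (intro summable_norm_cancel[OF summable_gauss_term]) simp
      then show ?case using eq[OF elim] by (subst suminf_mult[symmetric]) auto
    qed
  qed
qed

end

theorem gauss_hypergeometric_sums:
  fixes x y c :: complex
  assumes c: "Re (c - x - y) > 0"
  shows "(\<lambda>n. pochhammer x n * pochhammer y n / fact n * rGamma (c + of_nat n))
    sums (Gamma (c - x - y) * rGamma (c - x) * rGamma (c - y))"
proof -
  let ?f = "\<lambda>c. suminf (gauss_term x y c)"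
  have nz: "c - x - y \<notin> \<int>\<^sub>\<le>\<^sub>0" using c by (auto elim!: nonpos_Ints_cases simp: complex_eq_iff)
  have "(\<lambda>n. rGamma_series (c - x) n * rGamma_series (c - y) n / rGamma_series (c - x - y) n
      * (rGamma (c + of_nat (Suc n)) * fact n * exp (c * of_real (ln (real n))))
      * (Gamma (c + of_nat (Suc n)) * ?f (c + of_nat (Suc n))))
    \<longlonglongrightarrow> rGamma (c - x) * rGamma (c - y) / rGamma (c - x - y) * 1 * 1"
    using nz by (intro tendsto_mult tendsto_divide rGamma_limit rGamma_series_LIMSEQ LIMSEQ_Suc[OF gauss_limit[OF c]])
      (auto simp: rGamma_eq_zero_iff)
  moreover have "\<forall>\<^sub>F n in sequentially. rGamma_series (c - x) n * rGamma_series (c - y) n / rGamma_series (c - x - y) n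
      * (rGamma (c + of_nat (Suc n)) * fact n * exp (c * of_real (ln (real n))))
      * (Gamma (c + of_nat (Suc n)) * ?f (c + of_nat (Suc n))) = ?f c"
  proof -
    obtain N0 :: nat where N0: "Re c + N0 > 0"
      using nat_shift_positive by blast
    show ?thesis using eventually_ge_at_top[of N0]
    proof eventually_elim
      case (elim n)
      define L where "L = complex_of_real (ln (real n))"
      have "c + of_nat (Suc n) \<notin> \<int>\<^sub>\<le>\<^sub>0"
        using elim N0 by (auto elim!: nonpos_Ints_cases simp: complex_eq_iff)
      then have g: "rGamma (c + of_nat (Suc n)) * Gamma (c + of_nat (Suc n)) = 1"
        by (simp add: rGamma_inverse_Gamma Gamma_eq_zero_iff)
      have p: "pochhammer (c - x - y) (Suc n) \<noteq> 0"
        using nz pochhammer_eq_0_imp_nonpos_Int by blast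
      have ex: "exp ((c - x) * L) * exp ((c - y) * L) = exp ((c - x - y) * L) * exp (c * L)"
        by (simp add: exp_add[symmetric] algebra_simps)
      have "rGamma_series (c - x) n * rGamma_series (c - y) n / rGamma_series (c - x - y) n
            * (fact n * exp (c * L))
          = pochhammer (c - x) (Suc n) * pochhammer (c - y) (Suc n) / pochhammer (c - x - y) (Suc n)
            * ((exp ((c - x - y) * L) * exp (c * L)) / (exp ((c - x) * L) * exp ((c - y) * L)))"
        unfolding rGamma_series_def L_def[symmetric] by (simp add: L_def mult_ac)
      also have "\<dots> = pochhammer (c - x) (Suc n) * pochhammer (c - y) (Suc n) / pochhammer (c - x - y) (Suc n)"
        unfolding ex[symmetric] by simp
      finally have quot: "rGamma_series (c - x) n * rGamma_series (c - y) n / rGamma_series (c - x - y) n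
            * (fact n * exp (c * L)) = \<dots>" .
      have "rGamma_series (c - x) n * rGamma_series (c - y) n / rGamma_series (c - x - y) n
            * (fact n * exp (c * L)) * ?f (c + of_nat (Suc n)) = ?f c"
      proof -
        have "?f c = rGamma_series (c - x) n * rGamma_series (c - y) n / rGamma_series (c - x - y) n
            * (fact n * exp (c * L)) * ?f (c + of_nat (Suc n))"
          using p unfolding quot by (subst times_divide_eq_left, subst gauss_contiguous_iterated[OF c, of "Suc n"]) simp
        then show ?thesis ..
      qed
      then have "rGamma_series (c - x) n * rGamma_series (c - y) n / rGamma_series (c - x - y) n
            * (fact n * exp (c * L)) * ?f (c + of_nat (Suc n)) * (rGamma (c + of_nat (Suc n)) * Gamma (c + of_nat (Suc n))) = ?f c"
        by (simp only: g mult_1_right)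
      then show ?case unfolding L_def by (simp only: mult_ac)
    qed
  qed
  ultimately have "(\<lambda>_::nat. ?f c) \<longlonglongrightarrow> rGamma (c - x) * rGamma (c - y) / rGamma (c - x - y) * 1 * 1"
    by (rule Lim_transform_eventually)
  then have "?f c = rGamma (c - x) * rGamma (c - y) / rGamma (c - x - y)"
    by (simp add: LIMSEQ_const_iff)
  also have "\<dots> = Gamma (c - x - y) * rGamma (c - x) * rGamma (c - y)"
    by (simp add: Gamma_def field_simps)
  finally have "?f c = Gamma (c - x - y) * rGamma (c - x) * rGamma (c - y)" .
  moreover have "summable (gauss_term x y c)"
    by (rule summable_norm_cancel[OF summable_gauss_term[OF c]])
  ultimately have "gauss_term x y c sums (Gamma (c - x - y) * rGamma (c - x) * rGamma (c - y))"
    by (metis summable_sums)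
  then show ?thesis by (simp only: gauss_term_def[abs_def])
qed

section \<open>Factorial series and their multipliers\<close>

text \<open>
  If \<open>A\<close> holds the coefficients of \<open>\<Sum>k. A\<^sub>k / \<Gamma>(s + k + z)\<close>, these are the coefficients of its product
  with \<open>\<Gamma>(a + z) / \<Gamma>(b + z)\<close>, expanded at the index \<open>s + b - a\<close>. This is the recursion step that
  defines the coefficients in the theorem.
\<close>
definition gquot_coeff :: "complex \<Rightarrow> complex \<Rightarrow> complex \<Rightarrow> (nat \<Rightarrow> complex) \<Rightarrow> nat \<Rightarrow> complex" where
  "gquot_coeff a b s A k = (\<Sum>j\<le>k. pochhammer (s - a + of_nat j) (k - j) * pochhammer (b - a) (k - j) / fact (k - j) * A j)"

text \<open>
  The coefficients, at the index \<open>s - 1\<close>, of the product with \<open>z + e\<close>: write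
  \<open>z + e = (s - 1 + k + z) + (e - s - k + 1)\<close> and absorb the first summand in \<open>1 / \<Gamma>(s + k + z)\<close>.
\<close>
fun lin_coeff :: "complex \<Rightarrow> complex \<Rightarrow> (nat \<Rightarrow> complex) \<Rightarrow> nat \<Rightarrow> complex" where
  "lin_coeff e s A 0 = A 0"
| "lin_coeff e s A (Suc k) = A (Suc k) + (e - s - of_nat k + 1) * A k"

lemma sum_lin_coeff:
  "(\<Sum>j\<le>k. g j * lin_coeff e s A j)
    = (\<Sum>j<k. (g j + g (Suc j) * (e - s - of_nat j + 1)) * A j) + g k * A k"
  by (induction k) (simp_all add: algebra_simps)

lemma sum_atMost_last:
  fixes g :: "nat \<Rightarrow> 'a :: comm_monoid_add"
  shows "(\<Sum>j\<le>k. g j) = (\<Sum>j<k. g j) + g k"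
  by (cases k) (simp_all add: lessThan_Suc_atMost)

lemma contiguous_up_aux:
  fixes x y :: complex
  shows "pochhammer (x - 1) (Suc i) * pochhammer (y + 1) (Suc i) / fact (Suc i)
      + pochhammer x i * pochhammer (y + 1) i / fact i * (y - x + 1)
    = pochhammer x (Suc i) * pochhammer y (Suc i) / fact (Suc i)"
proof -
  have f: "(1 :: complex) / fact i = of_nat (Suc i) / fact (Suc i)"
    by (simp add: fact_Suc del: of_nat_Suc)
  define P Q F where "P = pochhammer x i" and "Q = pochhammer (y + 1) i" and "F = (1 :: complex) / fact (Suc i)"
  have 1: "pochhammer (x - 1) (Suc i) = (x - 1) * P" by (simp add: pochhammer_rec P_def)
  have 2: "pochhammer (y + 1) (Suc i) = Q * (y + 1 + of_nat i)" by (simp add: pochhammer_Suc Q_def)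
  have 3: "pochhammer x (Suc i) = P * (x + of_nat i)" by (simp add: pochhammer_Suc P_def)
  have 4: "pochhammer y (Suc i) = y * Q" by (simp add: pochhammer_rec Q_def)
  have "pochhammer x i * pochhammer (y + 1) i / fact i * (y - x + 1)
      = P * Q * (1 / fact i) * (y - x + 1)" by (simp add: P_def Q_def)
  also have "\<dots> = P * Q * F * of_nat (Suc i) * (y - x + 1)"
    by (subst f) (simp add: F_def del: of_nat_Suc)
  finally have 5: "pochhammer x i * pochhammer (y + 1) i / fact i * (y - x + 1) = \<dots>" .
  have 6: "u / fact (Suc i) = u * F" for u by (simp add: F_def)
  show ?thesis unfolding 5 1 2 3 4 6 by (simp add: algebra_simps)
qed

lemma contiguous_lin_aux:
  fixes x y e a b :: complex
  assumes "b = y + a"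
  shows "pochhammer x (Suc i) * pochhammer y (Suc i) / fact (Suc i)
      + pochhammer x i * pochhammer y i / fact i * (e - x - b - of_nat i + 1)
    = pochhammer (x - 1) (Suc i) * pochhammer y (Suc i) / fact (Suc i)
      + pochhammer x i * pochhammer y i / fact i * (e - x - a + 1)"
proof -
  have f: "(1 :: complex) / fact i = of_nat (Suc i) / fact (Suc i)"
    by (simp add: fact_Suc del: of_nat_Suc)
  define P Q F where "P = pochhammer x i" and "Q = pochhammer y i" and "F = (1 :: complex) / fact (Suc i)"
  have 1: "pochhammer (x - 1) (Suc i) = (x - 1) * P" by (simp add: pochhammer_rec P_def)
  have 2: "pochhammer y (Suc i) = Q * (y + of_nat i)" by (simp add: pochhammer_Suc Q_def)
  have 3: "pochhammer x (Suc i) = P * (x + of_nat i)" by (simp add: pochhammer_Suc P_def)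
  have 5: "pochhammer x i * pochhammer y i / fact i * u = P * Q * F * of_nat (Suc i) * u" for u
  proof -
    have "pochhammer x i * pochhammer y i / fact i * u = P * Q * (1 / fact i) * u"
      by (simp add: P_def Q_def)
    then show ?thesis by (subst (asm) f) (simp add: F_def del: of_nat_Suc)
  qed
  have 6: "u / fact (Suc i) = u * F" for u by (simp add: F_def)
  show ?thesis unfolding 5 1 2 3 6 assms by (simp add: algebra_simps)
qed

text \<open>
  On the level of functions: \<open>\<Gamma>(a + z) / \<Gamma>(b + z) = (b + z) \<cdot> \<Gamma>(a + z) / \<Gamma>(b + 1 + z)\<close>. As an identity
  between coefficients it holds without any convergence, and it allows \<open>Re (b - a)\<close> to be made
  positive at the cost of linear factors.
\<close>
lemma gquot_coeff_raise:
  "gquot_coeff a b s A = gquot_coeff a (b + 1) (s - 1) (lin_coeff b s A)"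
proof
  fix k
  define g where "g j = pochhammer (s - 1 - a + of_nat j) (k - j) * pochhammer (b + 1 - a) (k - j) / fact (k - j)" for j
  have "gquot_coeff a (b + 1) (s - 1) (lin_coeff b s A) k
      = (\<Sum>j<k. (g j + g (Suc j) * (b - s - of_nat j + 1)) * A j) + g k * A k"
    unfolding gquot_coeff_def g_def[symmetric] sum_lin_coeff ..
  also have "(\<Sum>j<k. (g j + g (Suc j) * (b - s - of_nat j + 1)) * A j)
      = (\<Sum>j<k. pochhammer (s - a + of_nat j) (k - j) * pochhammer (b - a) (k - j) / fact (k - j) * A j)"
  proof (intro sum.cong refl, goal_cases)
    case (1 j)
    then obtain i where k: "k = j + Suc i" by (auto simp: less_iff_Suc_add)
    have "g j + g (Suc j) * (b - s - of_nat j + 1)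
        = pochhammer (s - a + of_nat j - 1) (Suc i) * pochhammer (b - a + 1) (Suc i) / fact (Suc i)
          + pochhammer (s - a + of_nat j) i * pochhammer (b - a + 1) i / fact i * (b - a - (s - a + of_nat j) + 1)"
      unfolding g_def k by (simp add: algebra_simps)
    also have "\<dots> = pochhammer (s - a + of_nat j) (k - j) * pochhammer (b - a) (k - j) / fact (k - j)"
      unfolding contiguous_up_aux by (simp add: k)
    finally show ?case by simp
  qed
  also have "\<dots> + g k * A k = gquot_coeff a b s A k"
    by (simp add: gquot_coeff_def sum_atMost_last g_def)
  finally show "gquot_coeff a b s A k = gquot_coeff a (b + 1) (s - 1) (lin_coeff b s A) k" ..
qed

text \<open>Multiplication by \<open>z + e\<close> and by \<open>\<Gamma>(a + z) / \<Gamma>(b + z)\<close> commute, already for coefficients.\<close>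
lemma lin_coeff_gquot_coeff:
  "lin_coeff e (s + b - a) (gquot_coeff a b s A) = gquot_coeff a b (s - 1) (lin_coeff e s A)"
proof
  fix k
  define g where "g j = pochhammer (s - 1 - a + of_nat j) (k - j) * pochhammer (b - a) (k - j) / fact (k - j)" for j
  have R: "gquot_coeff a b (s - 1) (lin_coeff e s A) k
      = (\<Sum>j<k. (g j + g (Suc j) * (e - s - of_nat j + 1)) * A j) + g k * A k"
    unfolding gquot_coeff_def g_def[symmetric] sum_lin_coeff ..
  show "lin_coeff e (s + b - a) (gquot_coeff a b s A) k = gquot_coeff a b (s - 1) (lin_coeff e s A) k"
  proof (cases k)
    case 0
    then show ?thesis by (simp add: gquot_coeff_def)
  next
    case (Suc m)
    define h where "h j = pochhammer (s - a + of_nat j) (k - j) * pochhammer (b - a) (k - j) / fact (k - j)" for j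
    define h' where "h' j = pochhammer (s - a + of_nat j) (m - j) * pochhammer (b - a) (m - j) / fact (m - j)" for j
    have "lin_coeff e (s + b - a) (gquot_coeff a b s A) k
        = (\<Sum>j\<le>k. h j * A j) + (e - (s + b - a) - of_nat m + 1) * (\<Sum>j\<le>m. h' j * A j)"
      by (simp add: Suc gquot_coeff_def h_def h'_def)
    also have "\<dots> = (\<Sum>j<k. (h j + h' j * (e - (s + b - a) - of_nat m + 1)) * A j) + h k * A k"
    proof -
      have "{..m} = {..<k}" using Suc by auto
      then show ?thesis
        unfolding sum_atMost_last[of _ k]
        by (simp only: sum_distrib_left sum.distrib[symmetric] add_ac) (simp add: sum.distrib[symmetric] algebra_simps)
    qed
    also have "\<dots> = (\<Sum>j<k. (g j + g (Suc j) * (e - s - of_nat j + 1)) * A j) + g k * A k"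
    proof (intro arg_cong2[of _ _ _ _ "(+)"] sum.cong refl, goal_cases)
      case (1 j)
      then obtain i where k: "k = j + Suc i" by (auto simp: less_iff_Suc_add)
      then have m: "m = j + i" using Suc by simp
      have "h j + h' j * (e - (s + b - a) - of_nat m + 1)
          = pochhammer (s - a + of_nat j) (Suc i) * pochhammer (b - a) (Suc i) / fact (Suc i)
            + pochhammer (s - a + of_nat j) i * pochhammer (b - a) i / fact i * (e - (s - a + of_nat j) - b - of_nat i + 1)"
        unfolding h_def h'_def k m by (simp add: algebra_simps)
      also have "\<dots> = pochhammer (s - a + of_nat j - 1) (Suc i) * pochhammer (b - a) (Suc i) / fact (Suc i)
            + pochhammer (s - a + of_nat j) i * pochhammer (b - a) i / fact i * (e - (s - a + of_nat j) - a + 1)"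
        by (rule contiguous_lin_aux) simp
      also have "\<dots> = g j + g (Suc j) * (e - s - of_nat j + 1)"
        unfolding g_def k by (simp add: algebra_simps)
      finally show ?case by simp
    next
      case 2
      then show ?case by (simp add: h_def g_def)
    qed
    finally show ?thesis unfolding R .
  qed
qed

text \<open>
  Absolute convergence of the factorial series for \<open>Re z > - d\<close>: the weight at \<open>Re s + \<zeta>\<close> stands for
  \<open>\<bar>\<Gamma>(s + k + z)\<bar>\<close> with \<open>\<zeta> = Re z\<close>.
\<close>
definition fs_bounded :: "real \<Rightarrow> complex \<Rightarrow> (nat \<Rightarrow> complex) \<Rightarrow> bool" where
  "fs_bounded d s A \<longleftrightarrow> (\<forall>\<zeta>>-d. summable (\<lambda>k. norm (A k) / gamma_weight k (Re s + \<zeta>)))"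

text \<open>
  Absolute values ignore the cancellation in \<open>lin_coeff\<close>, so boundedness alone is not preserved by
  linear factors. Taking the largest class that is preserved builds the cancellation into the
  hypothesis.
\<close>
coinductive fs_regular :: "real \<Rightarrow> complex \<Rightarrow> (nat \<Rightarrow> complex) \<Rightarrow> bool" for d where
  "fs_bounded d s A \<Longrightarrow> (\<And>e. fs_regular d (s - 1) (lin_coeff e s A)) \<Longrightarrow> fs_regular d s A"

lemma fs_regular_bounded: "fs_regular d s A \<Longrightarrow> fs_bounded d s A"
  by (erule fs_regular.cases) simp

lemma fs_regular_lin: "fs_regular d s A \<Longrightarrow> fs_regular d (s - 1) (lin_coeff e s A)"
  by (erule fs_regular.cases) simp

lemma fs_regular_finite:
  assumes "finite {k. A k \<noteq> 0}"
  shows "fs_regular d s A"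
  using assms
proof (coinduction arbitrary: s A)
  case fs_regular
  have "fs_bounded d s A"
    unfolding fs_bounded_def using fs_regular by (auto intro!: summable_finite[of "{k. A k \<noteq> 0}"])
  moreover have "finite {k. lin_coeff e s A k \<noteq> 0}" for e
  proof (rule finite_subset)
    show "{k. lin_coeff e s A k \<noteq> 0} \<subseteq> {k. A k \<noteq> 0} \<union> Suc ` {k. A k \<noteq> 0}"
    proof
      fix k assume "k \<in> {k. lin_coeff e s A k \<noteq> 0}"
      then show "k \<in> {k. A k \<noteq> 0} \<union> Suc ` {k. A k \<noteq> 0}" by (cases k) auto
    qed
  qed (use fs_regular in auto)
  ultimately show ?case by blast
qed

text \<open>
  The terms of \<open>gquot_coeff\<close> are dominated by a product of a function of \<open>j\<close> and a summable function
  of \<open>i = k - j\<close>. The weight leaves a factor \<open>(k + 1) powr - (Re b + \<zeta>)\<close>; it is split as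
  \<open>(i + 1) powr - (Re (b - a) + \<epsilon>)\<close> times \<open>(j + 1) powr - (Re a + \<zeta> - \<epsilon>)\<close>, both exponents being
  at most 0.
\<close>
lemma gquot_term_le:
  fixes a b s :: complex
  assumes ba: "Re (b - a) \<ge> 0" and \<epsilon>: "0 < \<epsilon>" "\<epsilon> \<le> Re a + \<zeta>"
  obtains C where "C > 0" "\<And>j i (w :: complex).
    norm (pochhammer (s - a + of_nat j) i * pochhammer (b - a) i / fact i * w) / gamma_weight (j + i) (Re (s + b - a) + \<zeta>)
      \<le> (norm w / gamma_weight j (Re s + (\<zeta> - \<epsilon>))) * (C * (real i + 1) powr (-1 - \<epsilon>))"
proof -
  obtain C1 where C1: "C1 > 0"
    "\<And>j i. norm (pochhammer (s - a + of_nat j) i) \<le> C1 * (gamma_weight (j + i) (Re (s - a)) / gamma_weight j (Re (s - a)))"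
    using pochhammer_le_gamma_weight[of "s - a"] by blast
  obtain C2 where C2: "C2 > 0" "\<And>n. norm (pochhammer (b - a) n) \<le> C2 * gamma_weight n (Re (b - a))"
    using pochhammer_le_gamma_weight_0[of "b - a"] by blast
  define \<beta> where "\<beta> = Re (b - a)"
  have "norm (pochhammer (s - a + of_nat j) i * pochhammer (b - a) i / fact i * w) / gamma_weight (j + i) (Re (s + b - a) + \<zeta>)
      \<le> (norm w / gamma_weight j (Re s + (\<zeta> - \<epsilon>))) * ((C1 * C2) * (real i + 1) powr (-1 - \<epsilon>))" for j i and w :: complex
  proof -
    define n where "n = j + i"
    define t where "t = Re (s - a)"
    have p: "norm (pochhammer (s - a + of_nat j) i * pochhammer (b - a) i / fact i * w)
        \<le> (C1 * (gamma_weight n t / gamma_weight j t)) * (C2 * gamma_weight i \<beta>) / fact i * norm w"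
      unfolding norm_mult norm_divide norm_fact n_def \<beta>_def t_def
      using C1 C2 gamma_weight_pos by (intro mult_mono divide_right_mono) (auto simp: less_imp_le)
    have wn: "gamma_weight n (Re (s + b - a) + \<zeta>) = gamma_weight n t * ((real n + 1) powr (\<beta> + \<epsilon>) * (real n + 1) powr (Re a + \<zeta> - \<epsilon>))"
    proof -
      have "Re (s + b - a) + \<zeta> = t + (\<beta> + \<epsilon> + (Re a + \<zeta> - \<epsilon>))" by (simp add: t_def \<beta>_def)
      then show ?thesis by (simp only: gamma_weight_add powr_add)
    qed
    have wi: "gamma_weight i \<beta> / fact i = (real i + 1) powr (\<beta> + \<epsilon>) * (real i + 1) powr (-1 - \<epsilon>)"
      by (simp add: gamma_weight_def powr_add[symmetric])
    have wj: "gamma_weight j (Re s + (\<zeta> - \<epsilon>)) = gamma_weight j t * (real j + 1) powr (Re a + \<zeta> - \<epsilon>)"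
    proof -
      have "Re s + (\<zeta> - \<epsilon>) = t + (Re a + \<zeta> - \<epsilon>)" by (simp add: t_def)
      then show ?thesis by (simp only: gamma_weight_add)
    qed
    have mi: "(real i + 1) powr (\<beta> + \<epsilon>) \<le> (real n + 1) powr (\<beta> + \<epsilon>)"
      using ba \<epsilon> by (intro powr_mono2) (auto simp: n_def \<beta>_def)
    have mj: "(real j + 1) powr (Re a + \<zeta> - \<epsilon>) \<le> (real n + 1) powr (Re a + \<zeta> - \<epsilon>)"
      using \<epsilon> by (intro powr_mono2) (auto simp: n_def)
    define X Y Z where "X = (real i + 1) powr (\<beta> + \<epsilon>)" and "Y = (real j + 1) powr (Re a + \<zeta> - \<epsilon>)"
      and "Z = (real n + 1) powr (\<beta> + \<epsilon>) * (real n + 1) powr (Re a + \<zeta> - \<epsilon>)"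
    have XY: "X > 0" "Y > 0" "X * Y \<le> Z"
      using mi mj by (auto simp: X_def Y_def Z_def intro!: mult_mono)
    have "norm (pochhammer (s - a + of_nat j) i * pochhammer (b - a) i / fact i * w) / gamma_weight n (Re (s + b - a) + \<zeta>)
        \<le> ((C1 * (gamma_weight n t / gamma_weight j t)) * (C2 * gamma_weight i \<beta>) / fact i * norm w) / gamma_weight n (Re (s + b - a) + \<zeta>)"
      by (intro divide_right_mono p) (simp add: gamma_weight_pos less_imp_le)
    also have "\<dots> = (C1 * C2) * (norm w / gamma_weight j t) * (gamma_weight i \<beta> / fact i) / Z"
      unfolding wn Z_def[symmetric] using gamma_weight_pos[of n t] by (simp add: field_simps)
    also have "\<dots> = (C1 * C2) * (norm w / gamma_weight j t) * (real i + 1) powr (-1 - \<epsilon>) * (X / Z)"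
      unfolding wi X_def[symmetric] by (simp add: mult_ac)
    also have "\<dots> \<le> (C1 * C2) * (norm w / gamma_weight j t) * (real i + 1) powr (-1 - \<epsilon>) * (1 / Y)"
    proof (rule mult_left_mono)
      show "X / Z \<le> 1 / Y"
        using XY less_le_trans[OF mult_pos_pos[OF XY(1,2)] XY(3)] by (simp add: field_simps)
    qed (use C1(1) C2(1) gamma_weight_pos[of j t] in auto)
    also have "(C1 * C2) * (norm w / gamma_weight j t) * (real i + 1) powr (-1 - \<epsilon>) * (1 / Y)
        = (norm w / gamma_weight j (Re s + (\<zeta> - \<epsilon>))) * ((C1 * C2) * (real i + 1) powr (-1 - \<epsilon>))"
      unfolding wj Y_def[symmetric] by (simp add: field_simps)
    finally show ?thesis by (simp only: n_def)
  qed
  with that[of "C1 * C2"] C1(1) C2(1) show ?thesis by simp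
qed

lemma fs_bounded_gquot_near:
  assumes A: "fs_bounded d s A" and d: "d \<le> Re a" and ba: "Re (b - a) \<ge> 0"
  shows "fs_bounded d (s + b - a) (gquot_coeff a b s A)"
  unfolding fs_bounded_def
proof (intro allI impI)
  fix \<zeta> :: real assume \<zeta>: "\<zeta> > - d"
  define \<epsilon> where "\<epsilon> = (\<zeta> + d) / 2"
  have \<epsilon>: "0 < \<epsilon>" "\<epsilon> \<le> Re a + \<zeta>" "\<zeta> - \<epsilon> > - d" using \<zeta> d by (auto simp: \<epsilon>_def field_simps)
  obtain C where C: "C > 0" "\<And>j i (w :: complex).
    norm (pochhammer (s - a + of_nat j) i * pochhammer (b - a) i / fact i * w) / gamma_weight (j + i) (Re (s + b - a) + \<zeta>)
      \<le> (norm w / gamma_weight j (Re s + (\<zeta> - \<epsilon>))) * (C * (real i + 1) powr (-1 - \<epsilon>))"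
    using gquot_term_le[OF ba \<epsilon>(1,2), of s] by blast
  define v u where "v j = norm (A j) / gamma_weight j (Re s + (\<zeta> - \<epsilon>))" and "u i = C * (real i + 1) powr (-1 - \<epsilon>)" for j i
  have "summable v" using A \<epsilon>(3) by (simp add: fs_bounded_def v_def[abs_def])
  moreover have "summable u" unfolding u_def[abs_def] using \<epsilon> by (intro summable_mult summable_shifted_powr) simp
  moreover have nn: "v j \<ge> 0" "u i \<ge> 0" for i j using C(1) gamma_weight_pos by (auto simp: v_def u_def less_imp_le)
  ultimately have sm: "summable (\<lambda>k. \<Sum>j\<le>k. v j * u (k - j))"
    by (intro summable_Cauchy_product) auto
  show "summable (\<lambda>k. norm (gquot_coeff a b s A k) / gamma_weight k (Re (s + b - a) + \<zeta>))"
  proof (rule summable_comparison_test'[OF sm, of 0])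
    fix k
    have "norm (gquot_coeff a b s A k) / gamma_weight k (Re (s + b - a) + \<zeta>)
      \<le> (\<Sum>j\<le>k. norm (pochhammer (s - a + of_nat j) (k - j) * pochhammer (b - a) (k - j) / fact (k - j) * A j))
          / gamma_weight k (Re (s + b - a) + \<zeta>)"
      unfolding gquot_coeff_def by (intro divide_right_mono norm_sum) (simp add: gamma_weight_pos less_imp_le)
    also have "\<dots> = (\<Sum>j\<le>k. norm (pochhammer (s - a + of_nat j) (k - j) * pochhammer (b - a) (k - j) / fact (k - j) * A j)
          / gamma_weight k (Re (s + b - a) + \<zeta>))"
      by (rule sum_divide_distrib)
    also have "\<dots> \<le> (\<Sum>j\<le>k. v j * u (k - j))"
    proof (rule sum_mono)
      fix j assume "j \<in> {..k}"
      then have "j + (k - j) = k" by simp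
      then show "norm (pochhammer (s - a + of_nat j) (k - j) * pochhammer (b - a) (k - j) / fact (k - j) * A j)
          / gamma_weight k (Re (s + b - a) + \<zeta>) \<le> v j * u (k - j)"
        using C(2)[of j "k - j" "A j"] by (simp add: v_def u_def)
    qed
    finally show "norm (norm (gquot_coeff a b s A k) / gamma_weight k (Re (s + b - a) + \<zeta>)) \<le> (\<Sum>j\<le>k. v j * u (k - j))"
      using gamma_weight_pos by (simp add: less_imp_le)
  qed
qed

lemma fs_bounded_gquot:
  assumes "fs_regular d s A" "d \<le> Re a"
  shows "fs_bounded d (s + b - a) (gquot_coeff a b s A)"
proof -
  have "fs_bounded d (s + b - a) (gquot_coeff a b s A)"
    if "Re (b - a) + real N > 0" "fs_regular d s A" for N b s A
    using that
  proof (induction N arbitrary: b s A)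
    case 0
    then show ?case by (intro fs_bounded_gquot_near fs_regular_bounded assms(2)) auto
  next
    case (Suc N)
    have "fs_bounded d (s - 1 + (b + 1) - a) (gquot_coeff a (b + 1) (s - 1) (lin_coeff b s A))"
      using Suc.prems by (intro Suc.IH fs_regular_lin) auto
    then show ?case by (simp add: gquot_coeff_raise[of a b])
  qed
  then show ?thesis using assms(1) nat_shift_positive by blast
qed

lemma fs_regular_gquot:
  assumes "fs_regular d s A" "d \<le> Re a"
  shows "fs_regular d (s + b - a) (gquot_coeff a b s A)"
  using assms(1)
proof (coinduction arbitrary: s A)
  case fs_regular
  have "\<exists>s' A'. s + b - a - 1 = s' + b - a \<and> lin_coeff e (s + b - a) (gquot_coeff a b s A) = gquot_coeff a b s' A' \<and> fs_regular d s' A'" for e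
    using fs_regular_lin[OF fs_regular, of e]
    by (intro exI[of _ "s - 1"] exI[of _ "lin_coeff e s A"]) (simp add: lin_coeff_gquot_coeff)
  moreover have "fs_bounded d (s + b - a) (gquot_coeff a b s A)"
    using fs_regular assms(2) by (rule fs_bounded_gquot)
  ultimately show ?case by blast
qed

lemma fs_summable:
  assumes "fs_bounded d s A" "Re z > - d"
  shows "summable (\<lambda>k. norm (A k * rGamma (s + of_nat k + z)))"
proof -
  obtain C where C: "C > 0" "\<And>n. norm (rGamma (s + z + of_nat n)) \<le> C / gamma_weight n (Re (s + z))"
    using rGamma_le_gamma_weight[of "s + z"] by blast
  have "summable (\<lambda>k. norm (A k) / gamma_weight k (Re s + Re z))"
    using assms by (simp add: fs_bounded_def)
  from summable_mult2[OF this, of C] show ?thesis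
  proof (rule summable_comparison_test'[of _ 0])
    fix k
    have "norm (A k) * norm (rGamma (s + z + of_nat k)) \<le> norm (A k) * (C / gamma_weight k (Re (s + z)))"
      by (intro mult_left_mono C) auto
    then show "norm (norm (A k * rGamma (s + of_nat k + z))) \<le> norm (A k) / gamma_weight k (Re s + Re z) * C"
      by (simp add: norm_mult add_ac)
  qed
qed

text \<open>A nonzero limit would make \<open>t\<close> as large as a multiple of the harmonic series.\<close>
lemma summable_weighted_limit_zero:
  fixes t :: "nat \<Rightarrow> complex"
  assumes "summable (\<lambda>n. norm (t n))" and "(\<lambda>n. (c - of_nat n) * t n) \<longlonglongrightarrow> L"
  shows "L = 0"
proof (rule ccontr)
  assume "L \<noteq> 0"
  have "(\<lambda>n. norm ((c - of_nat n) * t n)) \<longlonglongrightarrow> norm L"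
    by (intro tendsto_norm assms(2))
  then have ev: "\<forall>\<^sub>F n in sequentially. norm ((c - of_nat n) * t n) > norm L / 2"
    using \<open>L \<noteq> 0\<close> by (intro order_tendstoD) auto
  have "summable (\<lambda>n. inverse (of_nat n :: real))"
  proof (rule summable_comparison_test_ev)
    show "summable (\<lambda>n. 2 * (norm c + 1) / norm L * norm (t n))"
      by (intro summable_mult assms(1))
    show "\<forall>\<^sub>F n in sequentially. norm (inverse (of_nat n :: real)) \<le> 2 * (norm c + 1) / norm L * norm (t n)"
      using ev eventually_gt_at_top[of 0]
    proof eventually_elim
      case (elim n)
      have "norm (c - of_nat n) \<le> norm c + real n" using norm_triangle_ineq4[of c "of_nat n"] by simp
      also have "\<dots> \<le> (norm c + 1) * real n"
        using elim mult_left_mono[of 1 "real n" "norm c"] by (simp add: algebra_simps)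
      finally have "norm L / 2 \<le> (norm c + 1) * real n * norm (t n)"
        using elim(1) mult_right_mono[of "norm (c - of_nat n)" "(norm c + 1) * real n" "norm (t n)"]
        by (simp add: norm_mult)
      then show ?case using elim(2) \<open>L \<noteq> 0\<close> by (simp add: field_simps)
    qed
  qed
  then show False using not_summable_harmonic[where ?'a = real] by blast
qed

text \<open>
  The partial sums on both sides differ by the boundary term \<open>(e - s + 1 - n) t\<^sub>n\<close> with \<open>t\<close> absolutely
  summable. Regularity makes both series converge, hence the boundary term has a limit, which
  must be 0.
\<close>
lemma lin_coeff_sums:
  assumes A: "fs_regular d s A" and z: "Re z > - d"
    and h: "(\<lambda>k. A k * rGamma (s + of_nat k + z)) sums h"
  shows "(\<lambda>k. lin_coeff e s A k * rGamma (s - 1 + of_nat k + z)) sums ((z + e) * h)"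
proof -
  define t where "t k = A k * rGamma (s + of_nat k + z)" for k
  define c where "c = e - s + 1"
  define m where "m k = lin_coeff e s A k * rGamma (s - 1 + of_nat k + z)" for k
  have tsum: "summable (\<lambda>k. norm (t k))"
    unfolding t_def by (rule fs_summable[OF fs_regular_bounded[OF A] z])
  have "summable (\<lambda>k. norm (m k))"
    unfolding m_def by (rule fs_summable[OF fs_regular_bounded[OF fs_regular_lin[OF A]] z])
  then obtain M where M: "m sums M" using summable_norm_cancel summable_sums by blast
  have part: "(\<Sum>k<Suc n. m k) = (z + e) * (\<Sum>k<Suc n. t k) - (c - of_nat n) * t n" for n
  proof (induction n)
    case 0
    have "rGamma (s - 1 + z) = (s - 1 + z) * rGamma (s + z)"
      using rGamma_plus1[of "s - 1 + z"] by (simp add: add_ac)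
    then have "m 0 = (s - 1 + z) * t 0" by (simp add: m_def t_def)
    then show ?case by (simp add: c_def algebra_simps)
  next
    case (Suc n)
    have "s - 1 + of_nat (Suc n) + z = s + of_nat n + z" by simp
    then have "m (Suc n) = (A (Suc n) + (e - s - of_nat n + 1) * A n) * rGamma (s + of_nat n + z)"
      by (simp only: m_def lin_coeff.simps)
    moreover have "rGamma (s + of_nat n + z) = (s + of_nat n + z) * rGamma (s + of_nat (Suc n) + z)"
      using rGamma_plus1[of "s + of_nat n + z"] by (simp add: add_ac)
    ultimately have "m (Suc n) = (s + of_nat n + z) * t (Suc n) + (c - of_nat n) * t n"
      by (simp add: t_def c_def algebra_simps)
    then show ?case
      unfolding sum.lessThan_Suc[of _ "Suc n"] Suc
      by (simp add: c_def algebra_simps del: sum.lessThan_Suc)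
  qed
  have "(\<lambda>n. (z + e) * (\<Sum>k<Suc n. t k) - (\<Sum>k<Suc n. m k)) \<longlonglongrightarrow> (z + e) * h - M"
    using h M unfolding sums_def t_def by (intro tendsto_intros LIMSEQ_Suc)
  then have "(\<lambda>n. (c - of_nat n) * t n) \<longlonglongrightarrow> (z + e) * h - M" by (simp only: part) simp
  then have "(z + e) * h - M = 0" by (rule summable_weighted_limit_zero[OF tsum])
  then show ?thesis using M by (simp add: m_def[abs_def])
qed

lemma gquot_coeff_sums_near:
  assumes A: "fs_bounded d s A" and d: "d \<le> Re a" and ba: "Re (b - a) \<ge> 0" and z: "Re z > - d"
    and h: "(\<lambda>k. A k * rGamma (s + of_nat k + z)) sums h"
  shows "(\<lambda>k. gquot_coeff a b s A k * rGamma (s + b - a + of_nat k + z)) sums (Gamma (a + z) * rGamma (b + z) * h)"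
proof -
  define \<zeta> where "\<zeta> = Re z"
  define \<epsilon> where "\<epsilon> = (\<zeta> + d) / 2"
  have \<epsilon>: "0 < \<epsilon>" "\<epsilon> \<le> Re a + \<zeta>" "\<zeta> - \<epsilon> > - d" using z d by (auto simp: \<epsilon>_def \<zeta>_def field_simps)
  obtain C where C: "C > 0" "\<And>j i (w :: complex).
    norm (pochhammer (s - a + of_nat j) i * pochhammer (b - a) i / fact i * w) / gamma_weight (j + i) (Re (s + b - a) + \<zeta>)
      \<le> (norm w / gamma_weight j (Re s + (\<zeta> - \<epsilon>))) * (C * (real i + 1) powr (-1 - \<epsilon>))"
    using gquot_term_le[OF ba \<epsilon>(1,2), of s] by blast
  obtain D where D: "D > 0" "\<And>n. norm (rGamma (s + b - a + z + of_nat n)) \<le> D / gamma_weight n (Re (s + b - a + z))"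
    using rGamma_le_gamma_weight[of "s + b - a + z"] by blast
  define v u where "v j = norm (A j) / gamma_weight j (Re s + (\<zeta> - \<epsilon>))" and "u i = (C * (real i + 1) powr (-1 - \<epsilon>)) * D" for j i
  define f where "f j i = pochhammer (s - a + of_nat j) i * pochhammer (b - a) i / fact i * A j
      * rGamma (s + b - a + z + of_nat (j + i))" for j i
  have "(\<lambda>k. \<Sum>j\<le>k. f j (k - j)) sums suminf (\<lambda>j. A j * rGamma (s + of_nat j + z) * (Gamma (a + z) * rGamma (b + z)))"
  proof (rule double_series_antidiagonal[where u = u and v = v])
    show "summable v" using A \<epsilon>(3) by (simp add: fs_bounded_def v_def[abs_def])
    show "summable u" unfolding u_def[abs_def] using \<epsilon> by (intro summable_mult summable_mult2 summable_shifted_powr) simp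
    show "v j \<ge> 0" "u j \<ge> 0" for j using C(1) D(1) gamma_weight_pos by (auto simp: v_def u_def less_imp_le)
    show "norm (f j i) \<le> v j * u i" for j i
    proof -
      have "norm (f j i) \<le> norm (pochhammer (s - a + of_nat j) i * pochhammer (b - a) i / fact i * A j)
          * (D / gamma_weight (j + i) (Re (s + b - a + z)))"
        unfolding f_def by (subst norm_mult) (intro mult_left_mono D, simp)
      also have "\<dots> = norm (pochhammer (s - a + of_nat j) i * pochhammer (b - a) i / fact i * A j)
          / gamma_weight (j + i) (Re (s + b - a) + \<zeta>) * D"
        by (simp add: \<zeta>_def)
      also have "\<dots> \<le> v j * (C * (real i + 1) powr (-1 - \<epsilon>)) * D"
        unfolding v_def using D(1) by (intro mult_right_mono C) simp
      finally show ?thesis by (simp add: u_def mult_ac)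
    qed
    show "f j sums (A j * rGamma (s + of_nat j + z) * (Gamma (a + z) * rGamma (b + z)))" for j
    proof -
      define x c where "x = s - a + of_nat j" and "c = s + b - a + z + of_nat j"
      have e: "c - x - (b - a) = a + z" "c - x = b + z" "c - (b - a) = s + of_nat j + z"
        by (simp_all add: x_def c_def algebra_simps)
      have "Re (c - x - (b - a)) > 0" using z d unfolding e by simp
      from sums_mult[OF gauss_hypergeometric_sums[OF this], of "A j"]
      show ?thesis unfolding e by (simp add: f_def[abs_def] x_def c_def add_ac mult_ac)
    qed
  qed
  also have "(\<lambda>j. A j * rGamma (s + of_nat j + z) * (Gamma (a + z) * rGamma (b + z))) sums (h * (Gamma (a + z) * rGamma (b + z)))"
    by (intro sums_mult2 h)
  then have "suminf (\<lambda>j. A j * rGamma (s + of_nat j + z) * (Gamma (a + z) * rGamma (b + z))) = Gamma (a + z) * rGamma (b + z) * h"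
    using sums_unique by (fastforce simp: mult_ac)
  finally show ?thesis
    by (simp add: f_def gquot_coeff_def sum_distrib_right add_ac)
qed

lemma gquot_coeff_sums:
  assumes "fs_regular d s A" "d \<le> Re a" and z: "Re z > - d"
    and "(\<lambda>k. A k * rGamma (s + of_nat k + z)) sums h"
  shows "(\<lambda>k. gquot_coeff a b s A k * rGamma (s + b - a + of_nat k + z)) sums (Gamma (a + z) * rGamma (b + z) * h)"
proof -
  have main: "(\<lambda>k. gquot_coeff a b s A k * rGamma (s + b - a + of_nat k + z)) sums (Gamma (a + z) * rGamma (b + z) * h)"
    if "Re (b - a) + real N > 0" "fs_regular d s A" "(\<lambda>k. A k * rGamma (s + of_nat k + z)) sums h" for N b s A h
    using that
  proof (induction N arbitrary: b s A h)
    case 0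
    then show ?case by (intro gquot_coeff_sums_near[of d] fs_regular_bounded assms(2) z) auto
  next
    case (Suc N)
    have "(\<lambda>k. gquot_coeff a (b + 1) (s - 1) (lin_coeff b s A) k * rGamma (s - 1 + (b + 1) - a + of_nat k + z))
        sums (Gamma (a + z) * rGamma (b + 1 + z) * ((z + b) * h))"
      using Suc.prems z by (intro Suc.IH fs_regular_lin lin_coeff_sums[of d]) auto
    moreover have "(z + b) * rGamma (b + 1 + z) = rGamma (b + z)"
      using rGamma_plus1[of "b + z"] by (simp add: add_ac)
    then have "Gamma (a + z) * rGamma (b + 1 + z) * ((z + b) * h) = Gamma (a + z) * rGamma (b + z) * h"
      by (metis mult.assoc mult.commute)
    ultimately show ?case by (simp add: gquot_coeff_raise[of a b])
  qed
  obtain N where "Re (b - a) + real N > 0" using nat_shift_positive by blast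
  then show ?thesis using assms(1,4) by (rule main)
qed

section \<open>The coefficients of the theorem as factorial series coefficients\<close>

lemma sum_shift_Suc:
  fixes f :: "nat \<Rightarrow> 'a :: comm_monoid_add"
  shows "(\<Sum>i=m..n. f (Suc i)) = (\<Sum>i=Suc m..Suc n. f i)"
  by (rule sum.shift_bounds_cl_Suc_ivl [symmetric])

lemma hyp_coeff_Suc_Suc:
  "hyp_coeff (Suc (Suc q)) a b = gquot_coeff (a 3) (b 1)
     ((\<Sum>i=1..q+1. b (Suc i)) - (\<Sum>i=3..q+2. a (Suc i))) (hyp_coeff (Suc q) (\<lambda>i. a (Suc i)) (\<lambda>i. b (Suc i)))"
proof
  fix k
  have "(\<Sum>i=2..q+2. b i) - (\<Sum>i=3..q+3. a i)
      = (\<Sum>i=1..q+1. b (Suc i)) - (\<Sum>i=3..q+2. a (Suc i)) - a 3"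
  proof -
    have head: "(\<Sum>i=3..q+3. a i) = a 3 + (\<Sum>i=Suc 3..q+3. a i)"
      by (rule sum.atLeast_Suc_atMost) simp
    have index: "Suc 1 = 2" "Suc (q + 1) = q + 2" "Suc (q + 2) = q + 3" by simp_all
    show ?thesis unfolding sum_shift_Suc index head by (simp only: diff_diff_add add.commute)
  qed
  then show "hyp_coeff (Suc (Suc q)) a b k = gquot_coeff (a 3) (b 1)
     ((\<Sum>i=1..q+1. b (Suc i)) - (\<Sum>i=3..q+2. a (Suc i))) (hyp_coeff (Suc q) (\<lambda>i. a (Suc i)) (\<lambda>i. b (Suc i))) k"
    by (simp only: hyp_coeff.simps gquot_coeff_def atLeast0AtMost)
qed

lemma hyp_coeff_expansion:
  assumes "\<And>j. j \<in> {3..q+2} \<Longrightarrow> d \<le> Re (a j)"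
  shows hyp_coeff_regular: "fs_regular d ((\<Sum>i=1..q+1. b i) - (\<Sum>i=3..q+2. a i)) (hyp_coeff (Suc q) a b)" (is ?reg)
    and hyp_coeff_sums: "Re z > - d \<Longrightarrow>
      (\<lambda>k. hyp_coeff (Suc q) a b k * rGamma ((\<Sum>i=1..q+1. b i) - (\<Sum>i=3..q+2. a i) + of_nat k + z))
        sums ((\<Prod>j=3..q+2. Gamma (a j + z)) * (\<Prod>j=1..q+1. rGamma (b j + z)))" (is "_ \<Longrightarrow> ?sums")
proof -
  have "?reg \<and> (Re z > - d \<longrightarrow> ?sums)"
    using assms
  proof (induction q arbitrary: a b)
    case 0
    have "fs_regular d s (hyp_coeff (Suc 0) a b)" for s
      by (rule fs_regular_finite) simp
    moreover have "(\<lambda>k. hyp_coeff (Suc 0) a b k * rGamma (b 1 + of_nat k + z)) sums rGamma (b 1 + z)"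
      using sums_finite[of "{0}" "\<lambda>k. hyp_coeff (Suc 0) a b k * rGamma (b 1 + of_nat k + z)"] by simp
    ultimately show ?case by (simp del: hyp_coeff.simps)
  next
    case (Suc q)
    define s where "s = (\<Sum>i=1..q+1. b (Suc i)) - (\<Sum>i=3..q+2. a (Suc i))"
    define A where "A = hyp_coeff (Suc q) (\<lambda>i. a (Suc i)) (\<lambda>i. b (Suc i))"
    have IH: "fs_regular d s A \<and> (Re z > - d \<longrightarrow>
      (\<lambda>k. A k * rGamma (s + of_nat k + z)) sums ((\<Prod>j=3..q+2. Gamma (a (Suc j) + z)) * (\<Prod>j=1..q+1. rGamma (b (Suc j) + z))))"
      unfolding s_def A_def by (rule Suc.IH) (use Suc.prems in auto)
    have da: "d \<le> Re (a 3)" using Suc.prems[of 3] by simp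
    have hc: "hyp_coeff (Suc (Suc q)) a b = gquot_coeff (a 3) (b 1) s A"
      unfolding hyp_coeff_Suc_Suc s_def A_def ..
    have idx: "(\<Sum>i=1..Suc q+1. b i) - (\<Sum>i=3..Suc q+2. a i) = s + b 1 - a 3"
    proof -
      have "(\<Sum>i=1..Suc q+1. b i) = b 1 + (\<Sum>i=Suc 1..Suc q+1. b i)"
        "(\<Sum>i=3..Suc q+2. a i) = a 3 + (\<Sum>i=Suc 3..Suc q+2. a i)"
        by (rule sum.atLeast_Suc_atMost; simp)+
      then show ?thesis unfolding s_def sum_shift_Suc by (simp del: sum.cl_ivl_Suc)
    qed
    have pb: "(\<Prod>j=1..Suc q+1. rGamma (b j + z)) = rGamma (b 1 + z) * (\<Prod>j=1..q+1. rGamma (b (Suc j) + z))"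
    proof -
      have "(\<Prod>j=1..Suc q+1. rGamma (b j + z)) = rGamma (b 1 + z) * (\<Prod>j=Suc 1..Suc q+1. rGamma (b j + z))"
        by (rule prod.atLeast_Suc_atMost) simp
      then show ?thesis
        using prod.shift_bounds_cl_Suc_ivl[of "\<lambda>j. rGamma (b j + z)" 1 "q + 1"] by (simp del: prod.cl_ivl_Suc)
    qed
    have pa: "(\<Prod>j=3..Suc q+2. Gamma (a j + z)) = Gamma (a 3 + z) * (\<Prod>j=3..q+2. Gamma (a (Suc j) + z))"
    proof -
      have "(\<Prod>j=3..Suc q+2. Gamma (a j + z)) = Gamma (a 3 + z) * (\<Prod>j=Suc 3..Suc q+2. Gamma (a j + z))"
        by (rule prod.atLeast_Suc_atMost) simp
      then show ?thesis
        using prod.shift_bounds_cl_Suc_ivl[of "\<lambda>j. Gamma (a j + z)" 3 "q + 2"] by (simp del: prod.cl_ivl_Suc)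
    qed
    show ?case unfolding hc idx pa pb
    proof (intro conjI impI)
      show "fs_regular d (s + b 1 - a 3) (gquot_coeff (a 3) (b 1) s A)"
        using IH da by (intro fs_regular_gquot) auto
      assume z: "Re z > - d"
      from gquot_coeff_sums[OF conjunct1[OF IH] da z conjunct2[OF IH, rule_format, OF z], of "b 1"]
      show "(\<lambda>k. gquot_coeff (a 3) (b 1) s A k * rGamma (s + b 1 - a 3 + of_nat k + z)) sums
          (Gamma (a 3 + z) * (\<Prod>j=3..q+2. Gamma (a (Suc j) + z)) *
           (rGamma (b 1 + z) * (\<Prod>j=1..q+1. rGamma (b (Suc j) + z))))"
        by (simp only: mult_ac)
    qed
  qed
  then show ?reg "Re z > - d \<Longrightarrow> ?sums" by auto
qed

section \<open>Asymptotic expansion of Gamma quotients\<close>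

text \<open>The complex asymptotic scale; at \<open>n = 0\<close> the value is 0 for positive \<open>k\<close>.\<close>
definition inv_power :: "nat \<Rightarrow> nat \<Rightarrow> complex" where
  "inv_power k n = inverse (of_nat n ^ k)"

lemma inv_power_mult: "f \<in> O(inv_power j) \<Longrightarrow> g \<in> O(inv_power k) \<Longrightarrow> (\<lambda>n. f n * g n) \<in> O(inv_power (j + k))"
proof -
  assume "f \<in> O(inv_power j)" "g \<in> O(inv_power k)"
  then have "(\<lambda>n. f n * g n) \<in> O(\<lambda>n. inv_power j n * inv_power k n)" by (rule landau_o.big_mult)
  also have "(\<lambda>n. inv_power j n * inv_power k n) = inv_power (j + k)"
    by (simp add: fun_eq_iff inv_power_def power_add)
  finally show "(\<lambda>n. f n * g n) \<in> O(inv_power (j + k))" .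
qed

lemma inv_power_mono:
  assumes "k \<le> j" "f \<in> O(inv_power j)"
  shows "f \<in> O(inv_power k)"
proof (rule landau_o.big_trans[OF assms(2)])
  show "inv_power j \<in> O(inv_power k)"
  proof (rule bigoI)
    show "\<forall>\<^sub>F n in sequentially. norm (inv_power j n) \<le> 1 * norm (inv_power k n)"
      using eventually_gt_at_top[of 0]
      by eventually_elim
        (use assms(1) in \<open>auto simp: inv_power_def norm_inverse norm_power intro!: le_imp_inverse_le power_increasing\<close>)
  qed
qed

lemma inv_power_refl: "inv_power k \<in> O(inv_power k)"
  by (rule landau_o.big_refl)

lemma bigo_inv_power_of_real:
  fixes f :: "nat \<Rightarrow> real"
  assumes "f \<in> O(\<lambda>n. 1 / real n ^ k)"
  shows "(\<lambda>n. complex_of_real (f n)) \<in> O(inv_power k)"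
proof -
  from assms obtain c where "\<forall>\<^sub>F n in sequentially. norm (f n) \<le> c * norm (1 / real n ^ k)"
    by (elim landau_o.bigE)
  then show ?thesis
    by (intro bigoI[of _ c]) (simp add: inv_power_def norm_inverse norm_power divide_inverse)
qed

lemma inv_power_tendsto_0:
  assumes "f \<in> O(inv_power (Suc k))"
  shows "f \<longlonglongrightarrow> 0"
proof -
  have "f \<in> O(inv_power 1)" by (rule inv_power_mono[OF _ assms]) simp
  moreover have "inv_power 1 \<in> o(\<lambda>_. 1)"
  proof (rule smalloI_tendsto)
    show "(\<lambda>n. inv_power 1 n / 1) \<longlonglongrightarrow> 0"
      using lim_inverse_n[where ?'a = complex] by (simp add: inv_power_def)
  qed simp
  ultimately have "f \<in> o(\<lambda>_. 1)" by (rule landau_o.big_small_trans)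
  then show ?thesis by (auto dest: smalloD_tendsto)
qed

text \<open>
  A null sequence is the sum of its later increments. These are compared with the telescoping
  differences \<open>1/n\<^sup>k - 1/(n+1)\<^sup>k \<ge> 1/(2 n\<^sup>k\<^sup>+\<^sup>1)\<close>.
\<close>
lemma bigo_inv_power_from_increments:
  fixes u :: "nat \<Rightarrow> complex"
  assumes lim: "u \<longlonglongrightarrow> 0" and inc: "(\<lambda>n. u (Suc n) - u n) \<in> O(inv_power (Suc k))" and k: "k > 0"
  shows "u \<in> O(inv_power k)"
proof -
  define w where "w n = 1 / real n ^ k" for n
  from inc obtain c where c: "c > 0" "\<forall>\<^sub>F n in sequentially. norm (u (Suc n) - u n) \<le> c * norm (inv_power (Suc k) n)"
    by (elim landau_o.bigE)
  then obtain N where N: "\<And>n. n \<ge> N \<Longrightarrow> norm (u (Suc n) - u n) \<le> c * norm (inv_power (Suc k) n)" "N > 0"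
    unfolding eventually_sequentially by (metis Suc_leD zero_less_Suc)
  have step: "norm (u (Suc n) - u n) \<le> 2 * c * (w n - w (Suc n))" if n: "n \<ge> N" for n
  proof -
    have n0: "real n > 0" "real n \<ge> 1" using n N(2) by auto
    define r where "r = real n / (real n + 1)"
    have r: "0 \<le> r" "r \<le> 1" "1 - r = 1 / (real n + 1)" using n0 by (auto simp: r_def field_simps)
    have "r ^ k \<le> r" using r k power_decreasing[of 1 k r] by simp
    have "1 / real n ^ Suc k = 1 / real n ^ k * (1 / real n)" by simp
    also have "\<dots> \<le> 1 / real n ^ k * (2 * (1 - r))"
      using n0 unfolding r(3) by (intro mult_left_mono) (auto simp: field_simps)
    also have "\<dots> \<le> 1 / real n ^ k * (2 * (1 - r ^ k))"
      using \<open>r ^ k \<le> r\<close> by (intro mult_left_mono) auto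
    also have "\<dots> = 2 * (w n - w (Suc n))"
      using n0 by (simp add: w_def r_def power_divide field_simps)
    finally have "c * norm (inv_power (Suc k) n) \<le> c * (2 * (w n - w (Suc n)))"
      using c(1) by (intro mult_left_mono) (auto simp: inv_power_def norm_inverse norm_power norm_mult divide_inverse)
    with N(1)[OF n] show ?thesis by (simp add: mult_ac)
  qed
  have tel: "norm (u n) \<le> norm (u (n + j)) + 2 * c * (w n - w (n + j))" if "n \<ge> N" for n j
  proof (induction j)
    case (Suc j)
    have "norm (u (n + j)) \<le> norm (u (Suc (n + j))) + norm (u (Suc (n + j)) - u (n + j))"
      by (metis add.commute norm_minus_commute norm_triangle_sub)
    with Suc step[of "n + j"] that show ?case by (simp add: algebra_simps)
  qed simp
  have "norm (u n) \<le> 2 * c * w n" if "n \<ge> N" for n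
  proof (rule LIMSEQ_le_const)
    have "(\<lambda>j. norm (u (j + n)) + 2 * c * w n) \<longlonglongrightarrow> norm (0 :: complex) + 2 * c * w n"
      by (intro tendsto_add tendsto_const tendsto_norm LIMSEQ_ignore_initial_segment[OF lim])
    then show "(\<lambda>j. norm (u (j + n)) + 2 * c * w n) \<longlonglongrightarrow> 2 * c * w n" by simp
    have "norm (u n) \<le> norm (u (j + n)) + 2 * c * w n" for j
    proof -
      have "2 * c * (w n - w (n + j)) \<le> 2 * c * w n"
        using c(1) by (intro mult_left_mono) (auto simp: w_def)
      with tel[OF that, of j] show ?thesis by (simp add: add.commute)
    qed
    then show "\<exists>M. \<forall>j\<ge>M. norm (u n) \<le> norm (u (j + n)) + 2 * c * w n" by blast
  qed
  then show ?thesis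
    by (intro bigoI[of _ "2 * c"] eventually_mono[OF eventually_ge_at_top[of N]])
       (auto simp: w_def inv_power_def norm_inverse norm_power divide_inverse)
qed

text \<open>Sequences of the form \<open>1 + c/n + O(1/n\<^sup>2)\<close>; such expansions multiply by adding the \<open>c\<close>.\<close>
definition first_order :: "(nat \<Rightarrow> complex) \<Rightarrow> complex \<Rightarrow> bool" where
  "first_order f c \<longleftrightarrow> (\<lambda>n. f n - 1 - c * inv_power 1 n) \<in> O(inv_power 2)"

lemma inv_power_cmult: "f \<in> O(inv_power k) \<Longrightarrow> (\<lambda>n. c * f n) \<in> O(inv_power k)"
  by (cases "c = 0") auto

lemma first_order_minus_1:
  assumes "first_order f c"
  shows "(\<lambda>n. f n - 1) \<in> O(inv_power 1)"
proof -
  have "(\<lambda>n. f n - 1 - c * inv_power 1 n) \<in> O(inv_power 1)"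
    using assms unfolding first_order_def by (rule inv_power_mono[rotated]) simp
  from sum_in_bigo(1)[OF this inv_power_cmult[OF inv_power_refl[of 1], of c]] show ?thesis by simp
qed

lemma first_order_1: "first_order (\<lambda>_. 1) 0"
  by (simp add: first_order_def)

lemma first_order_mult:
  assumes f: "first_order f c" and g: "first_order g d"
  shows "first_order (\<lambda>n. f n * g n) (c + d)"
proof -
  have "(\<lambda>n. (f n - 1) * (g n - 1)) \<in> O(inv_power 2)"
    using inv_power_mult[OF first_order_minus_1[OF f] first_order_minus_1[OF g]] by (simp add: numeral_2_eq_2)
  from sum_in_bigo(1)[OF this sum_in_bigo(1)[OF f[unfolded first_order_def] g[unfolded first_order_def]]]
  show ?thesis unfolding first_order_def by (simp add: algebra_simps)
qed

lemma first_order_inverse: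
  assumes f: "first_order f c"
  shows "first_order (\<lambda>n. inverse (f n)) (- c)"
proof -
  have "(\<lambda>n. f n - 1) \<longlonglongrightarrow> 0"
    by (rule inv_power_tendsto_0[of _ 0]) (use first_order_minus_1[OF f] in simp)
  then have lim: "f \<longlonglongrightarrow> 1" by (simp add: LIM_zero_iff)
  then have nz: "\<forall>\<^sub>F n in sequentially. f n \<noteq> 0"
    by (rule tendsto_imp_eventually_ne) simp
  have "(\<lambda>n. inverse (f n)) \<longlonglongrightarrow> inverse 1" by (intro tendsto_inverse lim) simp
  then have b: "(\<lambda>n. inverse (f n)) \<in> O(inv_power 0)"
    by (auto simp: inv_power_def intro!: bigoI_tendsto[of _ _ 1])
  have "(\<lambda>n. (f n - 1) * (f n - 1)) \<in> O(inv_power (1 + 1))"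
    by (intro inv_power_mult first_order_minus_1[OF f])
  from inv_power_mult[OF this b] have "(\<lambda>n. (f n - 1) * (f n - 1) * inverse (f n)) \<in> O(inv_power 2)"
    by (simp add: numeral_2_eq_2)
  then have "(\<lambda>n. (f n - 1) * (f n - 1) * inverse (f n) - (f n - 1 - c * inv_power 1 n)) \<in> O(inv_power 2)"
    using f unfolding first_order_def by (rule sum_in_bigo(2))
  moreover have "\<forall>\<^sub>F n in sequentially. (f n - 1) * (f n - 1) * inverse (f n) - (f n - 1 - c * inv_power 1 n)
      = inverse (f n) - 1 - (- c) * inv_power 1 n"
    using nz by eventually_elim (simp add: field_simps)
  ultimately show ?thesis unfolding first_order_def by (subst (asm) landau_o.big.in_cong) auto
qed

lemma first_order_prod:
  assumes "finite S" "\<And>j. j \<in> S \<Longrightarrow> first_order (f j) (c j)"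
  shows "first_order (\<lambda>n. \<Prod>j\<in>S. f j n) (\<Sum>j\<in>S. c j)"
  using assms by (induction S rule: finite_induct) (auto intro: first_order_1 first_order_mult)

lemma power_of_ratio_expansion:
  fixes x :: complex
  shows "(\<lambda>n. exp (x * of_real (ln (1 + 1 / real n))) - (1 + x * inv_power 1 n + (x\<^sup>2 - x) / 2 * inv_power 2 n)) \<in> O(inv_power 3)"
proof -
  define L where "L n = ln (1 + 1 / real n)" for n :: nat
  define w where "w n = x * of_real (L n)" for n
  have L1: "L \<in> O(\<lambda>n. 1 / real n ^ 1)" unfolding L_def by real_asymp
  have L2: "(\<lambda>n. L n - 1 / real n + 1 / (2 * real n ^ 2)) \<in> O(\<lambda>n. 1 / real n ^ 3)" unfolding L_def by real_asymp
  have L3: "(\<lambda>n. (L n)\<^sup>2 - 1 / real n ^ 2) \<in> O(\<lambda>n. 1 / real n ^ 3)" unfolding L_def by real_asymp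
  have w1: "w \<in> O(inv_power 1)"
    unfolding w_def by (intro inv_power_cmult bigo_inv_power_of_real L1)
  then have w3: "(\<lambda>n. w n * (w n * w n)) \<in> O(inv_power 3)"
    using inv_power_mult[OF w1 inv_power_mult[OF w1 w1]] by (simp add: eval_nat_numeral)
  have "w \<longlonglongrightarrow> 0" by (rule inv_power_tendsto_0[of _ 0]) (use w1 in simp)
  then have small: "\<forall>\<^sub>F n in sequentially. norm (w n) < 1"
    by (auto dest!: tendstoD[of _ _ _ 1])
  have "(\<lambda>n. exp (w n) - (1 + w n + (w n)\<^sup>2 / 2)) \<in> O(\<lambda>n. w n * (w n * w n))"
  proof (rule bigoI)
    show "\<forall>\<^sub>F n in sequentially. norm (exp (w n) - (1 + w n + (w n)\<^sup>2 / 2)) \<le> exp 1 * norm (w n * (w n * w n))"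
      using small
    proof eventually_elim
      case (elim n)
      have "norm (exp (w n) - (\<Sum>i\<le>2. w n ^ i / fact i)) \<le> exp \<bar>Re (w n)\<bar> * norm (w n) ^ Suc 2 / fact 2"
        by (rule Taylor_exp)
      also have "\<dots> \<le> exp 1 * norm (w n) ^ Suc 2 / 1"
        using elim abs_Re_le_cmod[of "w n"] by (intro frac_le mult_mono) auto
      finally show ?case by (simp add: eval_nat_numeral norm_mult mult_ac)
    qed
  qed
  then have e: "(\<lambda>n. exp (w n) - (1 + w n + (w n)\<^sup>2 / 2)) \<in> O(inv_power 3)"
    using w3 by (rule landau_o.big_trans)
  have "(\<lambda>n. x * of_real (L n - 1 / real n + 1 / (2 * real n ^ 2))
      + x\<^sup>2 / 2 * of_real ((L n)\<^sup>2 - 1 / real n ^ 2)) \<in> O(inv_power 3)"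
    by (intro sum_in_bigo inv_power_cmult bigo_inv_power_of_real L2 L3)
  from sum_in_bigo(1)[OF e this]
  have "(\<lambda>n. exp (w n) - (1 + w n + (w n)\<^sup>2 / 2) + (x * of_real (L n - 1 / real n + 1 / (2 * real n ^ 2))
      + x\<^sup>2 / 2 * of_real ((L n)\<^sup>2 - 1 / real n ^ 2))) \<in> O(inv_power 3)" .
  also have "(\<lambda>n. exp (w n) - (1 + w n + (w n)\<^sup>2 / 2) + (x * of_real (L n - 1 / real n + 1 / (2 * real n ^ 2))
      + x\<^sup>2 / 2 * of_real ((L n)\<^sup>2 - 1 / real n ^ 2)))
    = (\<lambda>n. exp (w n) - (1 + x * inv_power 1 n + (x\<^sup>2 - x) / 2 * inv_power 2 n))"
  proof
    fix n
    have 1: "complex_of_real (L n - 1 / real n + 1 / (2 * real n ^ 2)) = of_real (L n) - inv_power 1 n + inv_power 2 n / 2"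
      by (simp add: inv_power_def inverse_eq_divide)
    have 2: "complex_of_real ((L n)\<^sup>2 - 1 / real n ^ 2) = (of_real (L n))\<^sup>2 - inv_power 2 n"
      by (simp add: inv_power_def inverse_eq_divide)
    show "exp (w n) - (1 + w n + (w n)\<^sup>2 / 2) + (x * of_real (L n - 1 / real n + 1 / (2 * real n ^ 2))
      + x\<^sup>2 / 2 * of_real ((L n)\<^sup>2 - 1 / real n ^ 2))
      = exp (w n) - (1 + x * inv_power 1 n + (x\<^sup>2 - x) / 2 * inv_power 2 n)"
      unfolding 1 2 by (simp add: w_def power_mult_distrib field_simps)
  qed
  finally show ?thesis unfolding w_def L_def .
qed

text \<open>
  The consecutive quotients \<open>q\<close> of this sequence are elementary,
  \<open>q n = (1 + 1/n)\<^sup>x (n + 1) / (n + 1 + x) = 1 + \<kappa>/n\<^sup>2 + O(1/n\<^sup>3)\<close> with \<open>\<kappa> = x (x + 1) / 2\<close>, and the limit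
  is 1. Increments then give the expansion in two rounds: first the error \<open>O(1/n)\<close>, then, after
  \<open>- \<kappa>/n\<close> is split off, the error \<open>O(1/n\<^sup>2)\<close>.
\<close>
lemma first_order_rGamma:
  fixes x :: complex
  shows "first_order (\<lambda>n. rGamma (x + of_nat (Suc n)) * fact n * exp (x * of_real (ln (real n)))) (- (x * (x + 1) / 2))"
proof -
  define \<rho> where "\<rho> n = rGamma (x + of_nat (Suc n)) * fact n * exp (x * of_real (ln (real n)))" for n
  define \<kappa> where "\<kappa> = x * (x + 1) / 2"
  define Q where "Q n = exp (x * of_real (ln (1 + 1 / real n)))" for n :: nat
  define i1 where "i1 n = inverse (x + of_nat (Suc n))" for n
  define q where "q n = of_nat (Suc n) * i1 n * Q n" for n
  obtain N :: nat where N: "Re x + real N > 0" using nat_shift_positive by blast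
  have large: "\<forall>\<^sub>F n in sequentially. n > N" by (rule eventually_gt_at_top)
  have nz: "x + of_nat (Suc n) \<noteq> 0" if "n > N" for n
    using that N by (auto simp: complex_eq_iff)
  have ratio: "\<rho> (Suc n) = \<rho> n * q n" if "n > N" for n
  proof -
    have "rGamma (x + of_nat (Suc n)) = (x + of_nat (Suc n)) * rGamma (x + of_nat (Suc (Suc n)))"
      using rGamma_plus1[of "x + of_nat (Suc n)"] by (simp add: add_ac)
    then have 1: "rGamma (x + of_nat (Suc (Suc n))) = rGamma (x + of_nat (Suc n)) * i1 n"
      using nz[OF that] by (simp add: i1_def field_simps)
    have "ln (real (Suc n)) = ln (real n) + ln (1 + 1 / real n)"
    proof -
      have "1 + 1 / real n = real (Suc n) / real n" using that by (simp add: field_simps)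
      then show ?thesis using that by (simp add: ln_div del: of_nat_Suc)
    qed
    then have 2: "exp (x * of_real (ln (real (Suc n)))) = exp (x * of_real (ln (real n))) * Q n"
      by (simp only: of_real_add distrib_left exp_add Q_def)
    show ?thesis unfolding \<rho>_def 1 2 q_def by (simp add: mult_ac)
  qed
  define E where "E n = Q n - (1 + x * inv_power 1 n + (x\<^sup>2 - x) / 2 * inv_power 2 n)" for n
  have E: "E \<in> O(inv_power 3)" unfolding E_def Q_def by (rule power_of_ratio_expansion)
  have nE: "(\<lambda>n. of_nat (Suc n) * E n) \<in> O(inv_power 2)"
  proof -
    have "(\<lambda>n. of_nat (Suc n) :: complex) \<in> O(\<lambda>n. of_nat n)"
      by (rule bigoI[of _ 2], rule eventually_mono[OF eventually_gt_at_top[of 0]]) (simp del: of_nat_Suc)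
    from landau_o.big_mult[OF this E] have "(\<lambda>n. of_nat (Suc n) * E n) \<in> O(\<lambda>n. of_nat n * inv_power 3 n)" .
    also have "(\<lambda>n. of_nat n * inv_power 3 n) = inv_power 2"
    proof
      show "of_nat n * inv_power 3 n = inv_power 2 n" for n
        by (cases "n = 0") (simp_all add: inv_power_def eval_nat_numeral)
    qed
    finally show ?thesis .
  qed
  have i1a: "(\<lambda>n. i1 n - inv_power 1 n) \<in> O(inv_power 2)"
  proof (rule bigoI)
    show "\<forall>\<^sub>F n in sequentially. norm (i1 n - inv_power 1 n) \<le> (2 * norm (x + 1)) * norm (inv_power 2 n)"
      using large eventually_gt_at_top[of "nat \<lceil>2 * norm (x + 1)\<rceil>"]
    proof eventually_elim
      case (elim n)
      have n: "real n > 0" "2 * norm (x + 1) \<le> real n" using elim by linarith+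
      have "norm (of_nat n + (x + 1)) \<ge> real n - norm (x + 1)"
        using norm_diff_ineq[of "of_nat n" "x + 1"] by simp
      then have low: "norm (x + of_nat (Suc n)) \<ge> real n / 2" using n by (simp add: add_ac)
      have "i1 n - inv_power 1 n = - (x + 1) / (of_nat n * (x + of_nat (Suc n)))"
        using nz[OF elim(1)] n(1) by (simp add: i1_def inv_power_def field_simps)
      then have "norm (i1 n - inv_power 1 n) = norm (x + 1) / (real n * norm (x + of_nat (Suc n)))"
        by (simp only: norm_divide norm_mult norm_of_nat norm_minus_cancel)
      also have "\<dots> \<le> norm (x + 1) / (real n * (real n / 2))"
        using n low by (intro divide_left_mono mult_left_mono mult_pos_pos) auto
      also have "\<dots> = (2 * norm (x + 1)) * norm (inv_power 2 n)"
        by (simp add: inv_power_def norm_inverse norm_power norm_mult norm_divide power2_eq_square field_simps)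
      finally show ?case .
    qed
  qed
  then have i1b: "i1 \<in> O(inv_power 1)"
    using sum_in_bigo(1)[OF inv_power_mono[OF _ i1a, of 1] inv_power_refl[of 1]] by simp
  have num: "\<forall>\<^sub>F n in sequentially. q n - 1 =
      i1 n * (\<kappa> * inv_power 1 n + (of_nat (Suc n) * E n + (x\<^sup>2 - x) / 2 * inv_power 2 n))"
    using large
  proof eventually_elim
    case (elim n)
    define y where "y = inv_power 1 n"
    have y: "of_nat n * y = 1" "inv_power 2 n = y * y"
      using elim by (simp_all add: y_def inv_power_def power2_eq_square)
    have i: "i1 n * (x + of_nat (Suc n)) = 1" using nz[OF elim] by (simp add: i1_def)
    have "q n - 1 = i1 n * (of_nat (Suc n) * Q n - (x + of_nat (Suc n)))"
      by (simp only: q_def right_diff_distrib i mult_ac)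
    also have "Q n = E n + (1 + x * y + (x\<^sup>2 - x) / 2 * (y * y))"
      by (simp add: E_def y(2) y_def)
    also have "of_nat (Suc n) * (E n + (1 + x * y + (x\<^sup>2 - x) / 2 * (y * y))) - (x + of_nat (Suc n))
        = \<kappa> * y + (of_nat (Suc n) * E n + (x\<^sup>2 - x) / 2 * (y * y))"
    proof -
      have expand: "of_nat (Suc n) * (e + (1 + x * y + h * (y * y))) - (x + of_nat (Suc n))
         = of_nat (Suc n) * e + h * (y * y) + (of_nat n * y - 1) * (x + h * y) + (x + h) * y" for e h
        by (simp add: algebra_simps)
      have \<kappa>: "x + (x\<^sup>2 - x) / 2 = \<kappa>"
        by (simp add: \<kappa>_def power2_eq_square field_simps)
      show ?thesis unfolding expand \<kappa> y(1) by (simp only: diff_self mult_zero_left add_0_left add_0_right add_ac)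
    qed
    finally show ?case by (simp add: y_def y(2)[unfolded y_def])
  qed
  have rem: "(\<lambda>n. of_nat (Suc n) * E n + (x\<^sup>2 - x) / 2 * inv_power 2 n) \<in> O(inv_power 2)"
    by (rule sum_in_bigo(1)[OF nE inv_power_cmult[OF inv_power_refl]])
  have "(\<lambda>n. (i1 n - inv_power 1 n) * (\<kappa> * inv_power 1 n) + i1 n * (of_nat (Suc n) * E n + (x\<^sup>2 - x) / 2 * inv_power 2 n)) \<in> O(inv_power 3)"
    by (rule sum_in_bigo(1)) (use inv_power_mult[OF i1a inv_power_cmult[OF inv_power_refl[of 1], of \<kappa>]] inv_power_mult[OF i1b rem] in
      \<open>simp_all add: eval_nat_numeral\<close>)
  also have "?this \<longleftrightarrow> (\<lambda>n. q n - 1 - \<kappa> * inv_power 2 n) \<in> O(inv_power 3)"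
  proof (rule landau_o.big.in_cong)
    show "\<forall>\<^sub>F n in sequentially. (i1 n - inv_power 1 n) * (\<kappa> * inv_power 1 n) + i1 n * (of_nat (Suc n) * E n + (x\<^sup>2 - x) / 2 * inv_power 2 n)
        = q n - 1 - \<kappa> * inv_power 2 n"
      using num by eventually_elim (simp add: inv_power_def power2_eq_square algebra_simps)
  qed
  finally have q3: "(\<lambda>n. q n - 1 - \<kappa> * inv_power 2 n) \<in> O(inv_power 3)" .
  have q2: "(\<lambda>n. q n - 1) \<in> O(inv_power 2)"
    using sum_in_bigo(1)[OF inv_power_mono[OF _ q3, of 2] inv_power_cmult[OF inv_power_refl[of 2], of \<kappa>]] by simp
  have lim: "\<rho> \<longlonglongrightarrow> 1" unfolding \<rho>_def by (rule rGamma_limit)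
  have \<rho>0: "\<rho> \<in> O(inv_power 0)" using lim by (auto simp: inv_power_def intro!: bigoI_tendsto[of _ _ 1])
  have incr: "\<forall>\<^sub>F n in sequentially. \<rho> (Suc n) - \<rho> n = \<rho> n * (q n - 1)"
    using large by eventually_elim (simp add: ratio algebra_simps)
  have \<rho>1: "(\<lambda>n. \<rho> n - 1) \<in> O(inv_power 1)"
  proof (rule bigo_inv_power_from_increments)
    show "(\<lambda>n. \<rho> n - 1) \<longlonglongrightarrow> 0" using lim by (simp add: LIM_zero_iff)
    have "(\<lambda>n. \<rho> n * (q n - 1)) \<in> O(inv_power 2)" using inv_power_mult[OF \<rho>0 q2] by (simp add: eval_nat_numeral)
    then have "(\<lambda>n. \<rho> (Suc n) - \<rho> n) \<in> O(inv_power 2)" using landau_o.big.in_cong[OF incr] by blast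
    then show "(\<lambda>n. \<rho> (Suc n) - 1 - (\<rho> n - 1)) \<in> O(inv_power (Suc 1))" by (simp add: numeral_2_eq_2)
  qed simp
  have "(\<lambda>n. \<rho> n - 1 + \<kappa> * inv_power 1 n) \<in> O(inv_power 2)"
  proof (rule bigo_inv_power_from_increments)
    have "(\<lambda>n. \<kappa> * inv_power 1 n) \<longlonglongrightarrow> 0"
      by (rule inv_power_tendsto_0[of _ 0]) (use inv_power_cmult[OF inv_power_refl[of 1], of \<kappa>] in simp)
    then show "(\<lambda>n. \<rho> n - 1 + \<kappa> * inv_power 1 n) \<longlonglongrightarrow> 0"
      using tendsto_add[of "\<lambda>n. \<rho> n - 1" 0 _ "\<lambda>n. \<kappa> * inv_power 1 n" 0] lim by (simp add: LIM_zero_iff)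
    have r: "(\<lambda>n::nat. 1 / real n ^ 2 - (1 / real n - 1 / real (Suc n))) \<in> O(\<lambda>n. 1 / real n ^ 3)"
      by real_asymp
    have "(\<lambda>n. (\<rho> n - 1) * (q n - 1)) \<in> O(inv_power 3)"
      using inv_power_mult[OF \<rho>1 q2] by (simp add: eval_nat_numeral)
    from sum_in_bigo(1)[OF sum_in_bigo(1)[OF this q3] inv_power_cmult[OF bigo_inv_power_of_real[OF r], of \<kappa>]]
    have "(\<lambda>n. (\<rho> n - 1) * (q n - 1) + (q n - 1 - \<kappa> * inv_power 2 n)
        + \<kappa> * of_real (1 / real n ^ 2 - (1 / real n - 1 / real (Suc n)))) \<in> O(inv_power 3)" .
    also have "?this \<longleftrightarrow> (\<lambda>n. \<rho> (Suc n) - 1 + \<kappa> * inv_power 1 (Suc n) - (\<rho> n - 1 + \<kappa> * inv_power 1 n)) \<in> O(inv_power 3)"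
    proof (rule landau_o.big.in_cong)
      show "\<forall>\<^sub>F n in sequentially. (\<rho> n - 1) * (q n - 1) + (q n - 1 - \<kappa> * inv_power 2 n)
          + \<kappa> * of_real (1 / real n ^ 2 - (1 / real n - 1 / real (Suc n)))
        = \<rho> (Suc n) - 1 + \<kappa> * inv_power 1 (Suc n) - (\<rho> n - 1 + \<kappa> * inv_power 1 n)"
        using incr
      proof eventually_elim
        case (elim n)
        have "\<kappa> * of_real (1 / real n ^ 2 - (1 / real n - 1 / real (Suc n))) = \<kappa> * inv_power 2 n - \<kappa> * inv_power 1 n + \<kappa> * inv_power 1 (Suc n)"
          by (simp add: inv_power_def inverse_eq_divide algebra_simps)
        with elim show ?case by (simp add: algebra_simps)
      qed
    qed
    finally show "(\<lambda>n. \<rho> (Suc n) - 1 + \<kappa> * inv_power 1 (Suc n) - (\<rho> n - 1 + \<kappa> * inv_power 1 n)) \<in> O(inv_power (Suc 2))"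
      by (simp add: eval_nat_numeral)
  qed simp
  then show ?thesis by (simp add: first_order_def \<rho>_def \<kappa>_def)
qed

text \<open>
  Each Gamma factor is a power of \<open>l\<close> times \<open>l!\<close> times a first-order expansion. The factorials cancel
  because \<open>S\<close> has one more element than \<open>T\<close>, and the powers combine to \<open>l\<^sup>-\<^sup>2\<close> by the condition on the
  sums of the parameters.
\<close>
lemma gamma_ratio_expansion:
  fixes a b :: "nat \<Rightarrow> complex" and S T :: "nat set"
  assumes fin: "finite S" "finite T" and card: "card S = Suc (card T)"
    and a: "\<And>j. j \<in> S \<Longrightarrow> a j \<notin> \<int>\<^sub>\<le>\<^sub>0"
    and sum: "(\<Sum>j\<in>T. b j) - (\<Sum>j\<in>S. a j) = 1"
  shows "(\<lambda>l. (\<Prod>j\<in>S. Gamma (a j + of_nat l)) * (\<Prod>j\<in>T. rGamma (b j + of_nat l)) * rGamma (1 + of_nat l)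
      - inv_power 2 l - ((\<Sum>j\<in>S. a j * (a j - 1) / 2) - (\<Sum>j\<in>T. b j * (b j - 1) / 2)) * inv_power 3 l) \<in> O(inv_power 4)"
proof -
  define t where "t l = (\<Prod>j\<in>S. Gamma (a j + of_nat l)) * (\<Prod>j\<in>T. rGamma (b j + of_nat l)) * rGamma (1 + of_nat l)" for l
  define c where "c = (\<Sum>j\<in>S. a j * (a j - 1) / 2) - (\<Sum>j\<in>T. b j * (b j - 1) / 2)"
  define \<rho> where "\<rho> x n = rGamma (x + of_nat (Suc n)) * fact n * exp (x * of_real (ln (real n)))" for x :: complex and n
  define R where "R n = (\<Prod>j\<in>S. inverse (\<rho> (a j - 1) n)) * (\<Prod>j\<in>T. \<rho> (b j - 1) n)" for n
  have fo: "first_order (\<rho> x) (- (x * (x + 1) / 2))" for x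
    unfolding \<rho>_def by (rule first_order_rGamma)
  have "first_order R ((\<Sum>j\<in>S. - (- ((a j - 1) * (a j - 1 + 1) / 2))) + (\<Sum>j\<in>T. - ((b j - 1) * (b j - 1 + 1) / 2)))"
    unfolding R_def using fin by (intro first_order_mult first_order_prod first_order_inverse fo)
  also have "(\<Sum>j\<in>S. - (- ((a j - 1) * (a j - 1 + 1) / 2))) + (\<Sum>j\<in>T. - ((b j - 1) * (b j - 1 + 1) / 2)) = c"
    by (simp add: c_def sum_negf mult.commute)
  finally have R: "(\<lambda>n. R n - 1 - c * inv_power 1 n) \<in> O(inv_power 2)" by (simp add: first_order_def)
  have tR: "t n = inv_power 2 n * R n" if n: "n > 0" for n
  proof -
    define L where "L = complex_of_real (ln (real n))"
    have inv: "inverse (\<rho> (a j - 1) n) = Gamma (a j + of_nat n) * inverse (fact n) * exp ((1 - a j) * L)" if "j \<in> S" for j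
      by (simp add: \<rho>_def L_def Gamma_def exp_minus[symmetric] algebra_simps add_ac)
    have dir: "\<rho> (b j - 1) n = rGamma (b j + of_nat n) * fact n * exp ((b j - 1) * L)" for j
      by (simp add: \<rho>_def L_def algebra_simps)
    have es: "(\<Prod>j\<in>S. exp ((1 - a j) * L)) = exp ((of_nat (card S) - (\<Sum>j\<in>S. a j)) * L)"
      by (simp add: exp_sum[OF fin(1), symmetric] sum_distrib_right[symmetric] sum_subtractf)
    have et: "(\<Prod>j\<in>T. exp ((b j - 1) * L)) = exp (((\<Sum>j\<in>T. b j) - of_nat (card T)) * L)"
      by (simp add: exp_sum[OF fin(2), symmetric] sum_distrib_right[symmetric] sum_subtractf)
    have "exp ((of_nat (card S) - (\<Sum>j\<in>S. a j)) * L) * exp (((\<Sum>j\<in>T. b j) - of_nat (card T)) * L)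
        = exp (((\<Sum>j\<in>T. b j) - (\<Sum>j\<in>S. a j) + 1) * L)"
      unfolding exp_add[symmetric] card by (simp add: algebra_simps)
    also have "\<dots> = exp (2 * L)" unfolding sum by simp
    also have "\<dots> = of_nat n ^ 2"
      using n by (simp add: exp_double L_def exp_of_real)
    finally have ex: "exp ((of_nat (card S) - (\<Sum>j\<in>S. a j)) * L) * exp (((\<Sum>j\<in>T. b j) - of_nat (card T)) * L) = of_nat n ^ 2" .
    have rG: "rGamma (1 + of_nat n) = (inverse (fact n) :: complex)"
      using Gamma_fact[of n, where ?'a = complex] by (simp add: rGamma_inverse_Gamma)
    have "R n = (\<Prod>j\<in>S. Gamma (a j + of_nat n) * inverse (fact n) * exp ((1 - a j) * L))
        * (\<Prod>j\<in>T. rGamma (b j + of_nat n) * fact n * exp ((b j - 1) * L))"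
      unfolding R_def dir using inv by (simp cong: prod.cong)
    also have "\<dots> = (\<Prod>j\<in>S. Gamma (a j + of_nat n)) * (\<Prod>j\<in>T. rGamma (b j + of_nat n))
        * (inverse (fact n) ^ card S * fact n ^ card T)
        * (exp ((of_nat (card S) - (\<Sum>j\<in>S. a j)) * L) * exp (((\<Sum>j\<in>T. b j) - of_nat (card T)) * L))"
      unfolding prod.distrib es et prod_constant by (simp only: mult_ac)
    also have "inverse (fact n) ^ card S * fact n ^ card T = (inverse (fact n) :: complex)"
      unfolding card by (simp add: power_inverse)
    also have "\<dots> = rGamma (1 + of_nat n)" by (rule rG [symmetric])
    finally show ?thesis unfolding ex using n by (simp add: t_def inv_power_def field_simps)
  qed
  have "(\<lambda>n. inv_power 2 n * (R n - 1 - c * inv_power 1 n)) \<in> O(inv_power 4)"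
    using inv_power_mult[OF inv_power_refl[of 2] R] by simp
  also have "?this \<longleftrightarrow> (\<lambda>n. t n - inv_power 2 n - c * inv_power 3 n) \<in> O(inv_power 4)"
  proof (rule landau_o.big.in_cong)
    show "\<forall>\<^sub>F n in sequentially. inv_power 2 n * (R n - 1 - c * inv_power 1 n) = t n - inv_power 2 n - c * inv_power 3 n"
      using eventually_gt_at_top[of 0]
      by eventually_elim (simp add: tR inv_power_def algebra_simps eval_nat_numeral)
  qed
  finally show ?thesis unfolding t_def c_def .
qed

lemma hyp_coeff_0: "hyp_coeff (Suc q) a b 0 = 1"
  by (induction q arbitrary: a b) (simp_all add: hyp_coeff_Suc_Suc gquot_coeff_def del: hyp_coeff.simps(2))

text \<open>
  This closed form reveals that \<open>A\<^sub>1\<close> is the second-order term of the factorial series: the quadratic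
  sums are those that occur in \<open>gamma_ratio_expansion\<close>.
\<close>
lemma hyp_coeff_1:
  fixes a b :: "nat \<Rightarrow> complex"
  defines "s \<equiv> \<lambda>q a b. (\<Sum>i=1..q+1. b i) - (\<Sum>i=3..q+2. a i) :: complex"
  shows "hyp_coeff (Suc q) a b 1
    = ((\<Sum>i=3..q+2. a i * (a i - 1)) - (\<Sum>i=1..q+1. b i * (b i - 1)) + s q a b * (s q a b - 1)) / 2"
proof (induction q arbitrary: a b)
  case 0
  show ?case by (simp add: s_def)
next
  case (Suc q)
  define a' b' where "a' i = a (Suc i)" and "b' i = b (Suc i)" for i
  have ha: "(\<Sum>i=3..Suc q+2. f (a i)) = f (a 3) + (\<Sum>i=3..q+2. f (a' i))" for f :: "complex \<Rightarrow> complex"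
    using sum.atLeast_Suc_atMost[of 3 "Suc q + 2" "\<lambda>i. f (a i)"] sum_shift_Suc[of "\<lambda>i. f (a i)" 3 "q + 2"]
    by (simp add: a'_def del: sum.cl_ivl_Suc)
  have hb: "(\<Sum>i=1..Suc q+1. f (b i)) = f (b 1) + (\<Sum>i=1..q+1. f (b' i))" for f :: "complex \<Rightarrow> complex"
    using sum.atLeast_Suc_atMost[of 1 "Suc q + 1" "\<lambda>i. f (b i)"] sum_shift_Suc[of "\<lambda>i. f (b i)" 1 "q + 1"]
    by (simp add: b'_def del: sum.cl_ivl_Suc)
  define X Y \<sigma> where "X = (\<Sum>i=3..q+2. a' i * (a' i - 1))" and "Y = (\<Sum>i=1..q+1. b' i * (b' i - 1))"
    and "\<sigma> = s q a' b'"
  have IH: "hyp_coeff (Suc q) a' b' 1 = (X - Y + \<sigma> * (\<sigma> - 1)) / 2"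
    unfolding X_def Y_def \<sigma>_def by (rule Suc.IH)
  have "hyp_coeff (Suc (Suc q)) a b 1 = gquot_coeff (a 3) (b 1) \<sigma> (hyp_coeff (Suc q) a' b') 1"
    unfolding hyp_coeff_Suc_Suc \<sigma>_def s_def a'_def b'_def ..
  also have "\<dots> = (\<sigma> - a 3) * (b 1 - a 3) + (X - Y + \<sigma> * (\<sigma> - 1)) / 2"
    using IH hyp_coeff_0[of q a' b'] by (simp add: gquot_coeff_def)
  also have "\<dots> = ((a 3 * (a 3 - 1) + X) - (b 1 * (b 1 - 1) + Y)
      + (\<sigma> + b 1 - a 3) * (\<sigma> + b 1 - a 3 - 1)) / 2"
    by (simp add: field_simps)
  also have "\<sigma> + b 1 - a 3 = s (Suc q) a b"
    unfolding \<sigma>_def s_def using ha[of "\<lambda>x. x"] hb[of "\<lambda>x. x"] by (simp del: sum.cl_ivl_Suc)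
  also have "a 3 * (a 3 - 1) + X = (\<Sum>i=3..Suc q+2. a i * (a i - 1))"
    unfolding X_def by (rule ha[symmetric])
  also have "b 1 * (b 1 - 1) + Y = (\<Sum>i=1..Suc q+1. b i * (b i - 1))"
    unfolding Y_def by (rule hb[symmetric])
  finally show ?case .
qed

section \<open>The value of the infinite sum and its tail\<close>

lemma two_power_le_binomial: "2 ^ min k l \<le> real ((k + l) choose k)"
proof -
  have le: "2 ^ m \<le> real ((m + n) choose m)" if "m \<le> n" for m n :: nat
  proof (cases "m = 0")
    case False
    then have "(2 :: real) ^ m \<le> (real (m + n) / real m) ^ m"
      using that by (intro power_mono) (auto simp: field_simps)
    also have "\<dots> \<le> real ((m + n) choose m)"
      using binomial_ge_n_over_k_pow_k[of m "m + n", where ?'a = real] by simp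
    finally show ?thesis .
  qed simp
  show ?thesis
  proof (cases "k \<le> l")
    case True
    then show ?thesis using le[of k l] by simp
  next
    case False
    then have "2 ^ min k l \<le> real ((l + k) choose l)" using le[of l k] by simp
    also have "(l + k) choose l = (k + l) choose k"
      using binomial_symmetric[of l "l + k"] by (simp add: add.commute)
    finally show ?thesis .
  qed
qed

text \<open>
  The quotient of both sides is \<open>R powr (t - 1)\<close> divided by a binomial coefficient, where \<open>R\<close> lies
  between 1 and \<open>min k l + 1\<close>; the binomial coefficient grows exponentially in \<open>min k l\<close>.
\<close>
lemma gamma_weight_mult_le:
  obtains K where "K > 0" "\<And>k l. gamma_weight k t * gamma_weight l t \<le> K * gamma_weight (k + l) t"
proof -
  define \<alpha> where "\<alpha> = \<bar>t - 1\<bar>"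
  have "(\<lambda>m::nat. (real m + 1) powr \<alpha>) \<in> O(\<lambda>m. 2 ^ m)" by real_asymp
  then obtain K where K: "K > 0" "\<And>m. norm ((real m + 1) powr \<alpha>) \<le> K * 2 ^ m"
    by (rule bigo_imp_bounded) auto
  have "gamma_weight k t * gamma_weight l t \<le> K * gamma_weight (k + l) t" for k l
  proof -
    define R where "R = (real k + 1) * (real l + 1) / (real (k + l) + 1)"
    have R1: "R \<ge> 1" by (simp add: R_def field_simps)
    have "max (real k) (real l) + 1 \<le> real (k + l) + 1" by simp
    moreover have "(real k + 1) * (real l + 1) = (real (min k l) + 1) * (max (real k) (real l) + 1)"
      by (simp add: min_def max_def mult.commute)
    ultimately have R2: "R \<le> real (min k l) + 1"
      unfolding R_def by (simp add: divide_le_eq mult_left_mono)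
    have "R powr (t - 1) \<le> R powr \<alpha>" using R1 by (intro powr_mono) (auto simp: \<alpha>_def)
    also have "\<dots> \<le> (real (min k l) + 1) powr \<alpha>" using R1 R2 by (intro powr_mono2) (auto simp: \<alpha>_def)
    also have "\<dots> \<le> K * 2 ^ min k l" using K(2)[of "min k l"] by simp
    also have "\<dots> \<le> K * real ((k + l) choose k)" using K(1) two_power_le_binomial by (intro mult_left_mono) auto
    finally have "R powr (t - 1) \<le> K * (fact (k + l) / (fact k * fact l))"
      by (simp add: binomial_fact)
    moreover have "R powr (t - 1) = (real k + 1) powr (t - 1) * (real l + 1) powr (t - 1) / (real (k + l) + 1) powr (t - 1)"
      by (simp add: R_def powr_divide powr_mult)
    ultimately show ?thesis by (simp add: gamma_weight_def field_simps)
  qed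
  with K(1) that show ?thesis by blast
qed

text \<open>
  For fixed \<open>k\<close> the sum over \<open>l\<close> is Gauss's series with parameters \<open>a1\<close>, \<open>a2\<close>, \<open>a1 + a2 + 1 + k\<close>, whose
  excess is \<open>1 + k\<close>. The exchange of summations is dominated by
  \<open>\<bar>A\<^sub>k\<bar> / \<bar>\<Gamma>(a1 + a2 + 1 + k)\<bar>\<close> times \<open>(l + 1)\<^sup>-\<^sup>2\<close>, up to constants; the point \<open>z = 0\<close> lies inside the
  half-plane of absolute convergence because \<open>d > 0\<close>.
\<close>
lemma fs_gauss_sums:
  fixes a1 a2 :: complex
  assumes a: "a1 \<notin> \<int>\<^sub>\<le>\<^sub>0" "a2 \<notin> \<int>\<^sub>\<le>\<^sub>0"
    and A: "fs_bounded d (a1 + a2 + 1) A" and d: "d > 0"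
    and h: "\<And>l. (\<lambda>k. A k * rGamma (a1 + a2 + 1 + of_nat k + of_nat l)) sums h l"
  defines "B \<equiv> \<lambda>k. pochhammer 1 k / (pochhammer (a1 + 1) k * pochhammer (a2 + 1) k) * A k"
  shows fs_gauss_summable: "summable B"
    and "(\<lambda>l. Gamma (a1 + of_nat l) * Gamma (a2 + of_nat l) * rGamma (1 + of_nat l) * h l) sums (1 / (a1 * a2) * suminf B)"
proof -
  define \<alpha> where "\<alpha> = Re a1 + Re a2 + 1"
  obtain C1 where C1: "C1 > 0" "\<And>n. norm (Gamma (a1 + of_nat n)) \<le> C1 * gamma_weight n (Re a1)"
    using Gamma_le_gamma_weight[OF a(1)] by blast
  obtain C2 where C2: "C2 > 0" "\<And>n. norm (Gamma (a2 + of_nat n)) \<le> C2 * gamma_weight n (Re a2)"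
    using Gamma_le_gamma_weight[OF a(2)] by blast
  obtain C3 where C3: "C3 > 0" "\<And>n. norm (rGamma (a1 + a2 + 1 + of_nat n)) \<le> C3 / gamma_weight n (Re (a1 + a2 + 1))"
    using rGamma_le_gamma_weight[of "a1 + a2 + 1"] by blast
  obtain K where K: "K > 0" "\<And>k l. gamma_weight k \<alpha> * gamma_weight l \<alpha> \<le> K * gamma_weight (k + l) \<alpha>"
    using gamma_weight_mult_le[of \<alpha>] by blast
  define w where "w l = Gamma (a1 + of_nat l) * Gamma (a2 + of_nat l) / fact l" for l
  define f where "f k l = A k * (w l * rGamma (a1 + a2 + 1 + of_nat (k + l)))" for k l
  define v u where "v k = norm (A k) / gamma_weight k \<alpha>" and "u l = (C1 * C2 * C3 * K) * (real l + 1) powr (-2)" for k l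
  have bound: "norm (f k l) \<le> v k * u l" for k l
  proof -
    have "norm (w l) \<le> (C1 * gamma_weight l (Re a1)) * (C2 * gamma_weight l (Re a2)) / fact l"
      unfolding w_def norm_mult norm_divide norm_fact
      using C1 C2 gamma_weight_pos by (intro mult_mono divide_right_mono) (auto simp: less_imp_le)
    also have "\<dots> = C1 * C2 * (gamma_weight l \<alpha> * (real l + 1) powr (-2))"
      by (simp add: gamma_weight_def \<alpha>_def powr_add[symmetric])
    finally have w: "norm (w l) \<le> C1 * C2 * (gamma_weight l \<alpha> * (real l + 1) powr (-2))" .
    have "norm (f k l) \<le> norm (A k) * ((C1 * C2 * (gamma_weight l \<alpha> * (real l + 1) powr (-2))) * (C3 / gamma_weight (k + l) \<alpha>))"
      unfolding f_def norm_mult using C1(1) C2(1) C3(2)[of "k + l"] gamma_weight_pos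
      by (intro mult_left_mono mult_mono w) (auto simp: \<alpha>_def less_imp_le)
    also have "\<dots> = norm (A k) * (C1 * C2 * C3) * (real l + 1) powr (-2) * (gamma_weight l \<alpha> / gamma_weight (k + l) \<alpha>)"
      by simp
    also have "\<dots> \<le> norm (A k) * (C1 * C2 * C3) * (real l + 1) powr (-2) * (K / gamma_weight k \<alpha>)"
      using K(2)[of k l] gamma_weight_pos C1(1) C2(1) C3(1)
      by (intro mult_left_mono) (auto simp: divide_le_eq pos_le_divide_eq mult_ac)
    also have "\<dots> = v k * u l" by (simp add: v_def u_def)
    finally show ?thesis .
  qed
  have sv: "summable v"
    using A d by (auto simp: fs_bounded_def v_def[abs_def] \<alpha>_def dest: spec[of _ 0])
  have su: "summable u"
    unfolding u_def[abs_def] by (intro summable_mult summable_shifted_powr) simp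
  have nn: "u l \<ge> 0" "v l \<ge> 0" for l
    using C1(1) C2(1) C3(1) K(1) gamma_weight_pos by (auto simp: u_def v_def less_imp_le)
  have rows: "(\<lambda>l. f k l) sums (1 / (a1 * a2) * B k)" for k
  proof -
    define c where "c = a1 + a2 + 1 + of_nat k"
    have e: "c - a1 - a2 = 1 + of_nat k" "c - a1 = a2 + 1 + of_nat k" "c - a2 = a1 + 1 + of_nat k"
      by (simp_all add: c_def)
    have g: "Gamma a * rGamma (a + 1 + of_nat k) = 1 / (a * pochhammer (a + 1) k)" if "a \<notin> \<int>\<^sub>\<le>\<^sub>0" for a :: complex
    proof -
      have nz: "rGamma a \<noteq> 0" "a \<noteq> 0" using that by (auto simp: rGamma_eq_zero_iff)
      have "rGamma a = a * (pochhammer (a + 1) k * rGamma (a + 1 + of_nat k))"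
        using rGamma_plus1[of a] pochhammer_rGamma[of "a + 1" k] by simp
      then show ?thesis using nz by (auto simp: Gamma_def field_simps)
    qed
    have wl: "w l = Gamma a1 * Gamma a2 * (pochhammer a1 l * pochhammer a2 l / fact l)" for l
      using a by (simp add: w_def pochhammer_Gamma Gamma_eq_zero_iff)
    have "(\<lambda>l. pochhammer a1 l * pochhammer a2 l / fact l * rGamma (c + of_nat l))
        sums (Gamma (1 + of_nat k) * rGamma (a2 + 1 + of_nat k) * rGamma (a1 + 1 + of_nat k))"
      using gauss_hypergeometric_sums[of c a1 a2] unfolding e by simp
    from sums_mult[OF this, of "A k * (Gamma a1 * Gamma a2)"]
    have "(\<lambda>l. f k l) sums (A k * (Gamma a1 * Gamma a2) *
        (Gamma (1 + of_nat k) * rGamma (a2 + 1 + of_nat k) * rGamma (a1 + 1 + of_nat k)))"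
      by (simp add: f_def wl c_def add_ac mult_ac)
    also have "A k * (Gamma a1 * Gamma a2) *
        (Gamma (1 + of_nat k) * rGamma (a2 + 1 + of_nat k) * rGamma (a1 + 1 + of_nat k))
      = A k * Gamma (1 + of_nat k) * (Gamma a1 * rGamma (a1 + 1 + of_nat k)) * (Gamma a2 * rGamma (a2 + 1 + of_nat k))"
      by (simp only: mult_ac)
    also have "\<dots> = 1 / (a1 * a2) * B k"
      unfolding g[OF a(1)] g[OF a(2)] Gamma_fact by (simp add: B_def pochhammer_fact mult_ac)
    finally show ?thesis .
  qed
  have a0: "a1 \<noteq> 0" "a2 \<noteq> 0" using a by auto
  have "summable (\<lambda>k. 1 / (a1 * a2) * B k)"
    by (rule double_series_rows[OF bound su sv nn rows])
  then have "summable (\<lambda>k. a1 * a2 * (1 / (a1 * a2) * B k))" by (rule summable_mult)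
  then show B: "summable B" using a0 by simp
  have "(\<lambda>l. w l * h l) sums (\<Sum>k. 1 / (a1 * a2) * B k)"
  proof (rule double_series_swap[OF bound su sv nn rows])
    show "(\<lambda>k. f k l) sums (w l * h l)" for l
      using sums_mult[OF h[of l], of "w l"] by (simp add: f_def add_ac mult_ac)
  qed
  also have "(\<Sum>k. 1 / (a1 * a2) * B k) = 1 / (a1 * a2) * suminf B"
    by (rule suminf_mult[OF B])
  also have "(\<lambda>l. w l * h l) = (\<lambda>l. Gamma (a1 + of_nat l) * Gamma (a2 + of_nat l) * rGamma (1 + of_nat l) * h l)"
  proof
    fix l
    have "rGamma (1 + of_nat l) = (inverse (fact l) :: complex)"
      using Gamma_fact[of l, where ?'a = complex] by (simp add: rGamma_inverse_Gamma)
    then show "w l * h l = Gamma (a1 + of_nat l) * Gamma (a2 + of_nat l) * rGamma (1 + of_nat l) * h l"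
      by (simp add: w_def divide_inverse)
  qed
  finally show "(\<lambda>l. Gamma (a1 + of_nat l) * Gamma (a2 + of_nat l) * rGamma (1 + of_nat l) * h l)
      sums (1 / (a1 * a2) * suminf B)" .
qed

lemma prod_first_two:
  fixes f :: "nat \<Rightarrow> 'a :: comm_monoid_mult"
  shows "(\<Prod>j=1..q+2. f j) = f 1 * f 2 * (\<Prod>j=3..q+2. f j)"
proof -
  have "(\<Prod>j=1..q+2. f j) = f 1 * (\<Prod>j=Suc 1..q+2. f j)"
    "(\<Prod>j=Suc 1..q+2. f j) = f (Suc 1) * (\<Prod>j=Suc (Suc 1)..q+2. f j)"
    by (rule prod.atLeast_Suc_atMost; simp)+
  then show ?thesis by (simp add: numeral_2_eq_2 numeral_3_eq_3 mult.assoc)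
qed

lemma sum_first_two:
  fixes f :: "nat \<Rightarrow> 'a :: comm_monoid_add"
  shows "(\<Sum>j=1..q+2. f j) = f 1 + f 2 + (\<Sum>j=3..q+2. f j)"
proof -
  have "(\<Sum>j=1..q+2. f j) = f 1 + (\<Sum>j=Suc 1..q+2. f j)"
    "(\<Sum>j=Suc 1..q+2. f j) = f (Suc 1) + (\<Sum>j=Suc (Suc 1)..q+2. f j)"
    by (rule sum.atLeast_Suc_atMost; simp)+
  then show ?thesis by (simp add: numeral_2_eq_2 numeral_3_eq_3 add.assoc)
qed

text \<open>
  The remainder tends to 0, so by \<open>bigo_inv_power_from_increments\<close> it suffices that its increments are
  \<open>O(m\<^sup>-\<^sup>4)\<close>. Since \<open>1/(m - 1) - 1/m = m\<^sup>-\<^sup>2 + m\<^sup>-\<^sup>3 + O(m\<^sup>-\<^sup>4)\<close> and the increment of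
  \<open>1/((m - 1)(m - 2))\<close> is \<open>- 2 m\<^sup>-\<^sup>3 + O(m\<^sup>-\<^sup>4)\<close>, the coefficient of the latter must be \<open>(1 - c) / 2\<close>.
\<close>
lemma partial_sum_expansion:
  fixes t :: "nat \<Rightarrow> complex"
  assumes S: "t sums S" and t: "(\<lambda>l. t l - inv_power 2 l - c * inv_power 3 l) \<in> O(inv_power 4)"
  shows "(\<lambda>m. (\<Sum>l<m. t l) - (S - inverse (of_nat m - 1)
      + (1 - c) / 2 * inverse ((of_nat m - 1) * (of_nat m - 2)))) \<in> O(inv_power 3)"
proof -
  define \<kappa> where "\<kappa> = (1 - c) / 2"
  define r1 r2 where "r1 m = inverse (real m - 1)" and "r2 m = inverse ((real m - 1) * (real m - 2))" for m
  define e where "e m = (\<Sum>l<m. t l) - (S - of_real (r1 m) + \<kappa> * of_real (r2 m))" for m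
  have e: "(\<lambda>m. (\<Sum>l<m. t l) - (S - inverse (of_nat m - 1)
      + (1 - c) / 2 * inverse ((of_nat m - 1) * (of_nat m - 2)))) = e"
    by (simp add: fun_eq_iff e_def r1_def r2_def \<kappa>_def)
  have "r1 \<longlonglongrightarrow> 0" "r2 \<longlonglongrightarrow> 0" unfolding r1_def r2_def by real_asymp+
  then have "e \<longlonglongrightarrow> S - (S - of_real 0 + \<kappa> * of_real 0)"
    unfolding e_def by (intro tendsto_intros S[unfolded sums_def])
  then have lim: "e \<longlonglongrightarrow> 0" by simp
  have d1: "(\<lambda>m. r1 (Suc m) - r1 m + 1 / real m ^ 2 + 1 / real m ^ 3) \<in> O(\<lambda>m. 1 / real m ^ 4)"
    unfolding r1_def by real_asymp
  have d2: "(\<lambda>m. r2 (Suc m) - r2 m + 2 / real m ^ 3) \<in> O(\<lambda>m. 1 / real m ^ 4)"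
    unfolding r2_def by real_asymp
  have "(\<lambda>m. t m - inv_power 2 m - c * inv_power 3 m + of_real (r1 (Suc m) - r1 m + 1 / real m ^ 2 + 1 / real m ^ 3)
      - \<kappa> * of_real (r2 (Suc m) - r2 m + 2 / real m ^ 3)) \<in> O(inv_power 4)"
    by (rule sum_in_bigo(2)[OF sum_in_bigo(1)[OF t bigo_inv_power_of_real[OF d1]]
          inv_power_cmult[OF bigo_inv_power_of_real[OF d2]]])
  also have "(\<lambda>m. t m - inv_power 2 m - c * inv_power 3 m + of_real (r1 (Suc m) - r1 m + 1 / real m ^ 2 + 1 / real m ^ 3)
      - \<kappa> * of_real (r2 (Suc m) - r2 m + 2 / real m ^ 3)) = (\<lambda>m. e (Suc m) - e m)"
  proof
    fix m
    have 1: "complex_of_real (r1 (Suc m) - r1 m + 1 / real m ^ 2 + 1 / real m ^ 3)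
        = of_real (r1 (Suc m)) - of_real (r1 m) + inv_power 2 m + inv_power 3 m"
      by (simp add: inv_power_def inverse_eq_divide)
    have 2: "complex_of_real (r2 (Suc m) - r2 m + 2 / real m ^ 3)
        = of_real (r2 (Suc m)) - of_real (r2 m) + 2 * inv_power 3 m"
      by (simp add: inv_power_def inverse_eq_divide)
    have c: "c = 1 - 2 * \<kappa>" by (simp add: \<kappa>_def field_simps)
    show "t m - inv_power 2 m - c * inv_power 3 m + of_real (r1 (Suc m) - r1 m + 1 / real m ^ 2 + 1 / real m ^ 3)
      - \<kappa> * of_real (r2 (Suc m) - r2 m + 2 / real m ^ 3) = e (Suc m) - e m"
      unfolding 1 2 e_def c by (simp add: algebra_simps)
  qed
  finally have inc: "(\<lambda>m. e (Suc m) - e m) \<in> O(inv_power (Suc 3))" by (simp add: eval_nat_numeral)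
  show ?thesis unfolding e by (rule bigo_inv_power_from_increments[OF lim inc]) simp
qed

theorem theorem5:
  fixes p :: nat and a b :: "nat \<Rightarrow> complex"
  assumes "p \<ge> 1"
    and "\<And>j. j \<in> {1..p+1} \<Longrightarrow> a j \<notin> \<int>\<^sub>\<le>\<^sub>0"
    and "\<And>j. j \<in> {3..p+1} \<Longrightarrow> Re (a j) > 0"
    and "(\<Sum>j=1..p. b j) - (\<Sum>j=1..p+1. a j) = 1"
  shows "summable (\<lambda>k. pochhammer 1 k / (pochhammer (a 1 + 1) k * pochhammer (a 2 + 1) k)
                        * hyp_coeff p a b k)
    \<and> (\<lambda>m::nat.
            (\<Sum>l<m. (\<Prod>j=1..p+1. Gamma (a j + of_nat l))
                    * (\<Prod>j=1..p. rGamma (b j + of_nat l)) * rGamma (1 + of_nat l))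
            - (1 / (a 1 * a 2)
                 * (\<Sum>k. pochhammer 1 k / (pochhammer (a 1 + 1) k * pochhammer (a 2 + 1) k)
                          * hyp_coeff p a b k)
               - inverse (of_nat m - 1)
               + 1 / 2 * ((a 1 + 1) * (a 2 + 1) - hyp_coeff p a b 1)
                   * inverse ((of_nat m - 1) * (of_nat m - 2))))
         \<in> O(\<lambda>m. inverse (of_nat m ^ 3))"
proof -
  obtain q where p: "p = Suc q" using assms(1) by (cases p) auto
  define A where "A = hyp_coeff p a b"
  define B where "B k = pochhammer 1 k / (pochhammer (a 1 + 1) k * pochhammer (a 2 + 1) k) * A k" for k
  define t where "t l = (\<Prod>j=1..p+1. Gamma (a j + of_nat l)) * (\<Prod>j=1..p. rGamma (b j + of_nat l)) * rGamma (1 + of_nat l)" for l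
  \<comment> \<open>The 1 keeps the minimum meaningful for \<open>p = 1\<close>, where no upper parameter is left.\<close>
  define d where "d = Min (insert 1 ((\<lambda>j. Re (a j)) ` {3..q+2}))"
  have d0: "d > 0" unfolding d_def using assms(3) by (auto simp: p)
  have da: "d \<le> Re (a j)" if "j \<in> {3..q+2}" for j
    unfolding d_def using that by (intro Min_le) auto
  have idx: "{1..p+1} = {1..q+2}" "{1..p} = {1..q+1}" by (auto simp: p)
  have s: "(\<Sum>i=1..q+1. b i) - (\<Sum>i=3..q+2. a i) = a 1 + a 2 + 1"
    using assms(4) unfolding idx sum_first_two by (simp add: algebra_simps)
  have reg: "fs_regular d (a 1 + a 2 + 1) A"
    using hyp_coeff_regular[where q = q and d = d and a = a and b = b, OF da] unfolding s by (simp add: A_def p)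
  define h where "h l = (\<Prod>j=3..q+2. Gamma (a j + of_nat l)) * (\<Prod>j=1..q+1. rGamma (b j + of_nat l))" for l :: nat
  have hs: "(\<lambda>k. A k * rGamma (a 1 + a 2 + 1 + of_nat k + of_nat l)) sums h l" for l
    using hyp_coeff_sums[where q = q and d = d and a = a and b = b and z = "of_nat l", OF da] d0 unfolding s by (simp add: A_def p h_def)
  have a12: "a 1 \<notin> \<int>\<^sub>\<le>\<^sub>0" "a 2 \<notin> \<int>\<^sub>\<le>\<^sub>0" using assms(1,2) by auto
  have summable: "summable B"
    unfolding B_def by (rule fs_gauss_summable[OF a12 fs_regular_bounded[OF reg] d0 hs])
  have total: "t sums (1 / (a 1 * a 2) * suminf B)"
  proof -
    have teq: "t l = Gamma (a 1 + of_nat l) * Gamma (a 2 + of_nat l) * rGamma (1 + of_nat l) * h l" for l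
      unfolding t_def h_def idx prod_first_two by (simp only: mult_ac)
    show ?thesis
      unfolding teq[abs_def] B_def[abs_def]
      by (rule fs_gauss_sums(2)[OF a12 fs_regular_bounded[OF reg] d0 hs])
  qed
  define c where "c = (\<Sum>j=1..p+1. a j * (a j - 1) / 2) - (\<Sum>j=1..p. b j * (b j - 1) / 2)"
  have terms: "(\<lambda>l. t l - inv_power 2 l - c * inv_power 3 l) \<in> O(inv_power 4)"
    unfolding t_def c_def using assms(2,4) by (intro gamma_ratio_expansion) auto
  have coeff: "(1 - c) / 2 = 1 / 2 * ((a 1 + 1) * (a 2 + 1) - A 1)"
  proof -
    define X Y where "X = (\<Sum>i=3..q+2. a i * (a i - 1))" and "Y = (\<Sum>i=1..q+1. b i * (b i - 1))"
    have A1: "A 1 = (X - Y + (a 1 + a 2 + 1) * (a 1 + a 2 + 1 - 1)) / 2"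
      using hyp_coeff_1[of q a b] unfolding s X_def Y_def by (simp add: A_def p)
    have c: "c = (a 1 * (a 1 - 1) + a 2 * (a 2 - 1) + X - Y) / 2"
      unfolding c_def idx sum_first_two X_def Y_def
      by (simp add: sum_divide_distrib[symmetric] diff_divide_distrib add_divide_distrib del: sum.cl_ivl_Suc)
    show ?thesis unfolding A1 c by (simp add: field_simps)
  qed
  from summable partial_sum_expansion[OF total terms, unfolded coeff]
  show ?thesis
    unfolding t_def B_def[abs_def] A_def inv_power_def[abs_def] by blast
qed

end
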